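(* Let $H(x,y,z)=y$ on $\mathbb{R}^3$. For $\epsilon>0$ let $u=u_\epsilon$ be the solution of the two-ball insulated conductivity problem (described in the context) for this $H$. Then there is a constant $C>0$ independent of $\epsilon$ such that $$|\nabla u(x,0,0)|\ge C\,\frac{1}{\epsilon^{\frac{2-\sqrt2}{2}}}\qquad\text{for all } |x|<\frac{\epsilon}{2}$$ and all sufficiently small $\epsilon>0$.
   Context: For $\epsilon>0$, $B_1$ and $B_2$ denote the open unit balls in $\mathbb{R}^3$ centered at $(-1-\frac{\epsilon}{2},0,0)$ and $(1+\frac{\epsilon}{2},0,0)$ respectively, so that $\mathrm{dist}(B_1,B_2)=\epsilon$. Given a harmonic function $H$ on $\mathbb{R}^3$, the solution $u$ of the insulated conductivity problem is the function satisfying $\Delta u=0$ in $\mathbb{R}^3\setminus\overline{B_1\cup B_2}$, $\partial_\nu u=0$ on $\partial(B_1\cup B_2)$ ($\nu$ the unit normal), and $u(\mathbf{x})-H(\mathbf{x})=O(|\mathbf{x}|^{-2})$ as $|\mathbf{x}|\to\infty$. Points are written $\mathbf{x}=(x,y,z)$. "For all sufficiently small $\epsilon$" means for all $0<\epsilon<\epsilon_0$ for some $\epsilon_0>0$. *)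

theory Defs
  imports "HOL-Analysis.Analysis" "HOL-Library.Landau_Symbols"
begin

definition grad :: "('a::euclidean_space \<Rightarrow> real) \<Rightarrow> 'a \<Rightarrow> 'a" where
  "grad f x = (\<Sum>b\<in>Basis. frechet_derivative f (at x) b *\<^sub>R b)"

definition laplacian :: "('a::euclidean_space \<Rightarrow> real) \<Rightarrow> 'a \<Rightarrow> real" where
  "laplacian f x = (\<Sum>b\<in>Basis. frechet_derivative (grad f) (at x) b \<bullet> b)"

text \<open>Twice continuously differentiable; only meant for open \<open>S\<close>.\<close>

definition C2_on :: "'a::euclidean_space set \<Rightarrow> ('a \<Rightarrow> real) \<Rightarrow> bool" where
  "C2_on S f \<longleftrightarrow>
     (\<forall>x\<in>S. f differentiable (at x)) \<and>
     (\<forall>x\<in>S. grad f differentiable (at x)) \<and>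
     (\<forall>b\<in>Basis. continuous_on S (\<lambda>x. frechet_derivative (grad f) (at x) b))"

definition harmonic_on :: "'a::euclidean_space set \<Rightarrow> ('a \<Rightarrow> real) \<Rightarrow> bool" where
  "harmonic_on S f \<longleftrightarrow> open S \<and> C2_on S f \<and> (\<forall>x\<in>S. laplacian f x = 0)"

definition center1 :: "real \<Rightarrow> real^3" where
  "center1 \<epsilon> = vector [- 1 - \<epsilon> / 2, 0, 0]"

definition center2 :: "real \<Rightarrow> real^3" where
  "center2 \<epsilon> = vector [1 + \<epsilon> / 2, 0, 0]"

definition exterior :: "real \<Rightarrow> (real^3) set" where
  "exterior \<epsilon> = - closure (ball (center1 \<epsilon>) 1 \<union> ball (center2 \<epsilon>) 1)"

text \<open>
  Classical solutions: \<open>u\<close> is of class C2 in the exterior domain and of class C1 up to its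
  boundary, with \<open>G\<close> the gradient of \<open>u\<close> on the closed exterior domain (one-sided at boundary
  points), so that the Neumann condition can be read pointwise. The unit normal at a point \<open>p\<close>
  of the unit sphere about \<open>c\<close> is \<open>p - c\<close>; for \<open>\<epsilon> > 0\<close> the two spheres are disjoint and make up
  the boundary. The values of \<open>u\<close> inside the balls play no role.
\<close>

definition insulated_solution :: "real \<Rightarrow> (real^3 \<Rightarrow> real) \<Rightarrow> (real^3 \<Rightarrow> real) \<Rightarrow> bool" where
  "insulated_solution \<epsilon> H u \<longleftrightarrow>
     harmonic_on (exterior \<epsilon>) u \<and>
     (\<exists>G. continuous_on (closure (exterior \<epsilon>)) G \<and>
          (\<forall>p\<in>closure (exterior \<epsilon>).
             (u has_derivative (\<lambda>h. G p \<bullet> h)) (at p within closure (exterior \<epsilon>))) \<and>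
          (\<forall>c\<in>{center1 \<epsilon>, center2 \<epsilon>}. \<forall>p\<in>sphere c 1. G p \<bullet> (p - c) = 0)) \<and>
     (\<lambda>p. u p - H p) \<in> O[at_infinity](\<lambda>p. 1 / norm p ^ 2)"

end

theory Submission
  imports Defs
begin

text \<open>
  The proof is a comparison argument; write \<open>p = (x, y, z)\<close> and \<open>t = y\<^sup>2 + z\<^sup>2\<close>. Let \<open>U\<close> be the part
  of \<open>u\<close> that is odd in \<open>y\<close>; it vanishes on \<open>y = 0\<close> and has the same \<open>y\<close>-derivative as \<open>u\<close> on the
  axis. On \<open>y > 0\<close> any \<open>w\<close> with positive Laplacian and positive normal derivative on the spheres
  is such that \<open>w - U\<close> has no local maximum.

  First, the normal derivative of \<open>y\<close> on either sphere is \<open>y\<close> itself, so \<open>U \<ge> y\<close> for \<open>y \<ge> 0\<close>.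
  In the neck \<open>t \<le> 1/8\<close> between the balls this is improved by the barrier
  \<open>y (\<tau>\<^sup>\<mu> (1 + x\<^sup>2 (A/\<tau> + B \<epsilon>/\<tau>\<^sup>2 + 20)) + 30) / 100\<close> with \<open>\<tau> = t + 2 \<epsilon>\<close>. Averaging over the gap, whose
  width is about \<open>\<epsilon> + t\<close>, reduces \<open>y G(t)\<close> to the condition
  \<open>(\<epsilon> + t) (4 G' + 2 t G'') + G + 2 t G' \<ge> 0\<close>; for \<open>\<epsilon> = 0\<close> the power \<open>G = t\<^sup>\<mu>\<close> is a solution exactly
  when \<open>2 \<mu>\<^sup>2 + 4 \<mu> + 1 = 0\<close>, whose larger root is \<open>\<mu> = - (2 - sqrt 2) / 2\<close>. The shift \<open>2 \<epsilon>\<close> makes the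
  condition hold up to \<open>t = 0\<close>, and the constants \<open>20\<close> and \<open>30\<close> absorb the lower-order errors in
  the interior and on the spheres. On the axis the barrier has slope of order \<open>\<epsilon>\<^sup>\<mu>\<close>.
\<close>

section \<open>Second derivatives along a line\<close>

text \<open>A one-variable notion: the Laplacian enters the argument only through three such second
  derivatives, and for barriers and reflected functions they are easier to compute than the Frechet
  derivative of \<open>grad\<close>.\<close>

definition has_pure_second :: "(real^3 \<Rightarrow> real) \<Rightarrow> real^3 \<Rightarrow> real^3 \<Rightarrow> real \<Rightarrow> bool" where
  "has_pure_second F p b d \<longleftrightarrow>
     (\<exists>f'. (\<forall>\<^sub>F s in nhds 0. ((\<lambda>s. F (p + s *\<^sub>R b)) has_real_derivative f' s) (at s)) \<and>
           (f' has_real_derivative d) (at 0))"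

lemma has_pure_second_diff:
  assumes "has_pure_second F p b d" "has_pure_second F' p b d'"
  shows "has_pure_second (\<lambda>x. F x - F' x) p b (d - d')"
proof -
  from assms(1) obtain f where f: "\<forall>\<^sub>F s in nhds 0. ((\<lambda>s. F (p + s *\<^sub>R b)) has_real_derivative f s) (at s)"
    "(f has_real_derivative d) (at 0)" unfolding has_pure_second_def by blast
  from assms(2) obtain g where g: "\<forall>\<^sub>F s in nhds 0. ((\<lambda>s. F' (p + s *\<^sub>R b)) has_real_derivative g s) (at s)"
    "(g has_real_derivative d') (at 0)" unfolding has_pure_second_def by blast
  show ?thesis unfolding has_pure_second_def
  proof (intro exI conjI)
    show "\<forall>\<^sub>F s in nhds 0. ((\<lambda>s. F (p + s *\<^sub>R b) - F' (p + s *\<^sub>R b)) has_real_derivative (\<lambda>s. f s - g s) s) (at s)"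
      using f(1) g(1) by eventually_elim (auto intro: derivative_intros)
    show "((\<lambda>s. f s - g s) has_real_derivative d - d') (at 0)"
      using f(2) g(2) by (auto intro: derivative_intros)
  qed
qed

lemma has_pure_second_divide:
  assumes "has_pure_second F p b d"
  shows "has_pure_second (\<lambda>x. F x / k) p b (d / k)"
proof -
  from assms(1) obtain f where f: "\<forall>\<^sub>F s in nhds 0. ((\<lambda>s. F (p + s *\<^sub>R b)) has_real_derivative f s) (at s)"
    "(f has_real_derivative d) (at 0)" unfolding has_pure_second_def by blast
  show ?thesis unfolding has_pure_second_def
  proof (intro exI conjI)
    show "\<forall>\<^sub>F s in nhds 0. ((\<lambda>s. F (p + s *\<^sub>R b) / k) has_real_derivative (\<lambda>s. f s / k) s) (at s)"
      using f(1) by eventually_elim (auto intro: DERIV_cdivide)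
    show "((\<lambda>s. f s / k) has_real_derivative d / k) (at 0)"
      using f(2) by (auto intro: DERIV_cdivide)
  qed
qed

lemma has_pure_second_minus_direction:
  assumes "has_pure_second F p b d"
  shows "has_pure_second F p (- b) d"
proof -
  from assms(1) obtain f where f: "\<forall>\<^sub>F s in nhds 0. ((\<lambda>s. F (p + s *\<^sub>R b)) has_real_derivative f s) (at s)"
    "(f has_real_derivative d) (at 0)" unfolding has_pure_second_def by blast
  have m: "((\<lambda>s::real. - s) has_real_derivative -1) (at s)" for s
    by (auto intro!: derivative_eq_intros)
  have tn: "filterlim (\<lambda>s::real. - s) (nhds 0) (nhds 0)"
    using tendsto_minus[OF filterlim_ident[of "nhds (0::real)"]] by simp
  show ?thesis unfolding has_pure_second_def
  proof (intro exI conjI)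
    have "\<forall>\<^sub>F s in nhds 0. ((\<lambda>s. F (p + s *\<^sub>R b)) has_real_derivative f (- s)) (at (- s))"
      using eventually_compose_filterlim[OF f(1) tn] .
    then show "\<forall>\<^sub>F s in nhds 0. ((\<lambda>s. F (p + s *\<^sub>R (- b))) has_real_derivative (\<lambda>s. - f (- s)) s) (at s)"
    proof eventually_elim
      case (elim s)
      from DERIV_chain2[OF elim m] show ?case by simp
    qed
    have "((\<lambda>s. f (- s)) has_real_derivative d * (-1)) (at 0)"
      using DERIV_chain2[of f d "\<lambda>s. - s" 0 "-1" UNIV] f(2) m by simp
    from DERIV_minus[OF this] show "((\<lambda>s. - f (- s)) has_real_derivative d) (at 0)" by simp
  qed
qed

text \<open>Second derivative test: at a maximum the slope \<open>f 0\<close> vanishes, so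
  \<open>d > 0\<close> would make the slope positive just to the right of 0 and the function
  strictly increasing there.\<close>

lemma has_pure_second_local_max:
  assumes "has_pure_second F p b d"
    and max: "\<forall>\<^sub>F s in nhds 0. F (p + s *\<^sub>R b) \<le> F p"
  shows "d \<le> 0"
proof (rule ccontr)
  assume "\<not> d \<le> 0"
  then have d: "d > 0" by simp
  from assms(1) obtain f where f: "\<forall>\<^sub>F s in nhds 0. ((\<lambda>s. F (p + s *\<^sub>R b)) has_real_derivative f s) (at s)"
    "(f has_real_derivative d) (at 0)" unfolding has_pure_second_def by blast
  from f(1) max have "\<forall>\<^sub>F s in nhds 0. ((\<lambda>s. F (p + s *\<^sub>R b)) has_real_derivative f s) (at s) \<and> F (p + s *\<^sub>R b) \<le> F p"
    by eventually_elim auto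
  then obtain r where r: "r > 0" "\<And>s. dist s 0 < r \<Longrightarrow>
      ((\<lambda>s. F (p + s *\<^sub>R b)) has_real_derivative f s) (at s) \<and> F (p + s *\<^sub>R b) \<le> F p"
    unfolding eventually_nhds_metric by blast
  have f0: "f 0 = 0"
  proof (rule DERIV_local_max[of "\<lambda>s. F (p + s *\<^sub>R b)" "f 0" 0 r])
    show "((\<lambda>s. F (p + s *\<^sub>R b)) has_real_derivative f 0) (at 0)" using r by simp
  qed (use r in \<open>auto simp: dist_real_def\<close>)
  from DERIV_pos_inc_right[OF f(2) d] obtain q where q: "q > 0" "\<And>h. h > 0 \<Longrightarrow> h < q \<Longrightarrow> f 0 < f (0 + h)"
    by auto
  define h where "h = min r q / 2"
  have h: "0 < h" "h < r" "h < q" using r q by (auto simp: h_def min_def)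
  have "F (p + 0 *\<^sub>R b) < F (p + h *\<^sub>R b)"
  proof (rule DERIV_pos_imp_increasing_open[OF h(1)])
    fix x assume x: "0 < x" "x < h"
    show "\<exists>y. ((\<lambda>s. F (p + s *\<^sub>R b)) has_real_derivative y) (at x) \<and> 0 < y"
      using r(2)[of x] q(2)[of x] x h f0 by (auto simp: dist_real_def)
  next
    show "continuous_on {0..h} (\<lambda>s. F (p + s *\<^sub>R b))"
    proof (intro continuous_at_imp_continuous_on ballI)
      fix s assume "s \<in> {0..h}"
      then show "isCont (\<lambda>s. F (p + s *\<^sub>R b)) s"
        using r(2)[of s] h by (intro DERIV_isCont) (auto simp: dist_real_def)
    qed
  qed
  with r(2)[of h] h show False by (auto simp: dist_real_def)
qed

text \<open>On the line through \<open>p\<close> the slope of \<open>u\<close> is a component of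
  \<open>grad u\<close>, whose derivative at 0 is a diagonal entry of the Hessian.\<close>

lemma C2_on_has_pure_second:
  fixes u :: "real^3 \<Rightarrow> real"
  assumes "C2_on S u" "open S" "p \<in> S"
  shows "has_pure_second u p (axis i 1) (frechet_derivative (grad u) (at p) (axis i 1) \<bullet> axis i 1)"
proof -
  let ?b = "axis i 1 :: real^3"
  have bB: "?b \<in> Basis" by simp
  have line: "((\<lambda>s. p + s *\<^sub>R ?b) has_derivative (\<lambda>h. h *\<^sub>R ?b)) (at s)" for s
    by (auto intro!: derivative_eq_intros)
  have gb: "grad u q \<bullet> ?b = frechet_derivative u (at q) ?b" for q
    unfolding grad_def using bB by (simp add: inner_sum_left inner_Basis if_distrib sum.delta cong: if_cong)
  have "((\<lambda>s. p + s *\<^sub>R ?b) \<longlongrightarrow> p + 0 *\<^sub>R ?b) (nhds 0)"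
    by (intro tendsto_intros filterlim_ident)
  then have ev: "\<forall>\<^sub>F s in nhds 0. p + s *\<^sub>R ?b \<in> S"
    using assms(2,3) by (auto dest: topological_tendstoD)
  show ?thesis unfolding has_pure_second_def
  proof (intro exI conjI)
    show "\<forall>\<^sub>F s in nhds 0. ((\<lambda>s. u (p + s *\<^sub>R ?b)) has_real_derivative (\<lambda>s. grad u (p + s *\<^sub>R ?b) \<bullet> ?b) s) (at s)"
      using ev
    proof eventually_elim
      case (elim s)
      have "u differentiable (at (p + s *\<^sub>R ?b))" using assms(1) elim unfolding C2_on_def by blast
      then have D: "(u has_derivative frechet_derivative u (at (p + s *\<^sub>R ?b))) (at (p + s *\<^sub>R ?b))"
        by (simp add: frechet_derivative_works)
      from has_derivative_compose[OF line D]
      have "((\<lambda>s. u (p + s *\<^sub>R ?b)) has_derivative (\<lambda>h. frechet_derivative u (at (p + s *\<^sub>R ?b)) (h *\<^sub>R ?b))) (at s)" .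
      moreover have "frechet_derivative u (at (p + s *\<^sub>R ?b)) (h *\<^sub>R ?b) = (grad u (p + s *\<^sub>R ?b) \<bullet> ?b) * h" for h
        using linear_scale[OF has_derivative_linear[OF D]] gb by (simp add: mult.commute)
      ultimately show ?case by (simp add: has_field_derivative_def)
    qed
    have "grad u differentiable (at p)" using assms unfolding C2_on_def by blast
    then have D: "(grad u has_derivative frechet_derivative (grad u) (at p)) (at (p + 0 *\<^sub>R ?b))"
      by (simp add: frechet_derivative_works)
    from has_derivative_inner_left[OF has_derivative_compose[OF line[of 0] D], of ?b]
    have "((\<lambda>s. grad u (p + s *\<^sub>R ?b) \<bullet> ?b) has_derivative (\<lambda>h. frechet_derivative (grad u) (at p) (h *\<^sub>R ?b) \<bullet> ?b)) (at 0)" .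
    moreover have "frechet_derivative (grad u) (at p) (h *\<^sub>R ?b) \<bullet> ?b = (frechet_derivative (grad u) (at p) ?b \<bullet> ?b) * h" for h
      using linear_scale[OF has_derivative_linear[OF D]] by (simp add: mult.commute)
    ultimately show "((\<lambda>s. grad u (p + s *\<^sub>R ?b) \<bullet> ?b) has_real_derivative frechet_derivative (grad u) (at p) ?b \<bullet> ?b) (at 0)"
      by (simp add: has_field_derivative_def)
  qed
qed

lemma laplacian_eq_sum_axis:
  "laplacian (u :: real^3 \<Rightarrow> real) p = (\<Sum>i\<in>UNIV. frechet_derivative (grad u) (at p) (axis i 1) \<bullet> axis i 1)"
proof -
  have B: "(Basis :: (real^3) set) = (\<lambda>i. axis i 1) ` UNIV" by (auto simp: Basis_vec_def)
  have inj: "inj (\<lambda>i::3. axis i (1::real))" by (auto intro!: injI simp: axis_eq_axis)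
  show ?thesis unfolding laplacian_def B by (simp add: sum.reindex[OF inj])
qed

section \<open>Odd parts of solutions\<close>

definition cexterior :: "real \<Rightarrow> (real^3) set" where
  "cexterior \<epsilon> = {p. 1 \<le> dist (center1 \<epsilon>) p \<and> 1 \<le> dist (center2 \<epsilon>) p}"

definition yreflect :: "real^3 \<Rightarrow> real^3" where
  "yreflect p = vector [p $ 1, - p $ 2, p $ 3]"

lemma yreflect_nth [simp]:
  "yreflect p $ 1 = p $ 1" "yreflect p $ 2 = - p $ 2" "yreflect p $ 3 = p $ 3"
  by (simp_all add: yreflect_def)

lemma center_nth [simp]:
  "center1 \<epsilon> $ 1 = - 1 - \<epsilon> / 2" "center1 \<epsilon> $ 2 = 0" "center1 \<epsilon> $ 3 = 0"
  "center2 \<epsilon> $ 1 = 1 + \<epsilon> / 2" "center2 \<epsilon> $ 2 = 0" "center2 \<epsilon> $ 3 = 0"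
  by (simp_all add: center1_def center2_def)

lemma dist_vec3: "dist (p :: real^3) q = sqrt ((p$1 - q$1)\<^sup>2 + (p$2 - q$2)\<^sup>2 + (p$3 - q$3)\<^sup>2)"
  by (simp add: dist_vec_def L2_set_def sum_3 dist_real_def add.assoc)

lemma yreflect_add_scaleR: "yreflect (p + s *\<^sub>R q) = yreflect p + s *\<^sub>R yreflect q"
  by (simp add: vec_eq_iff forall_3)

lemma yreflect_center [simp]: "yreflect (center1 \<epsilon>) = center1 \<epsilon>" "yreflect (center2 \<epsilon>) = center2 \<epsilon>"
  by (simp_all add: vec_eq_iff forall_3)

lemma dist_yreflect [simp]: "dist (yreflect p) (yreflect q) = dist p q"
proof -
  have "(- p$2 + q$2)\<^sup>2 = (p$2 - q$2)\<^sup>2" by (simp add: power2_eq_square algebra_simps)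
  then show ?thesis by (simp add: dist_vec3)
qed

lemma norm_yreflect [simp]: "norm (yreflect p) = norm p"
proof -
  have "yreflect 0 = 0" by (simp add: vec_eq_iff forall_3)
  with dist_yreflect[of p 0] show ?thesis by simp
qed

lemma bounded_linear_yreflect: "bounded_linear yreflect"
proof (rule bounded_linear_intro[of _ 1])
  show "yreflect (x + y) = yreflect x + yreflect y" for x y
    using yreflect_add_scaleR[of x 1 y] by simp
  show "yreflect (r *\<^sub>R x) = r *\<^sub>R yreflect x" for r x
    by (simp add: vec_eq_iff forall_3)
qed simp

lemma yreflect_axis: "yreflect (axis i 1) = (if i = 2 then - axis i 1 else axis i 1)"
  using exhaust_3[of i] by (auto simp: vec_eq_iff forall_3 axis_def)

lemma dist_center_yreflect:
  "dist (center1 \<epsilon>) (yreflect p) = dist (center1 \<epsilon>) p"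
  "dist (center2 \<epsilon>) (yreflect p) = dist (center2 \<epsilon>) p"
  using dist_yreflect[of "center1 \<epsilon>" p] dist_yreflect[of "center2 \<epsilon>" p] by simp_all

lemma exterior_eq: "exterior \<epsilon> = {p. 1 < dist (center1 \<epsilon>) p \<and> 1 < dist (center2 \<epsilon>) p}"
  by (auto simp: exterior_def closure_Un not_le)

lemma open_exterior: "open (exterior \<epsilon>)"
  by (simp add: exterior_def open_Int open_Compl)

lemma closed_cexterior: "closed (cexterior \<epsilon>)"
  unfolding cexterior_def by (intro closed_Collect_conj closed_Collect_le continuous_intros)

lemma exterior_subset_cexterior: "exterior \<epsilon> \<subseteq> cexterior \<epsilon>"
  by (auto simp: exterior_eq cexterior_def)

lemma yreflect_mem_iff [simp]:
  "yreflect p \<in> exterior \<epsilon> \<longleftrightarrow> p \<in> exterior \<epsilon>"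
  "yreflect p \<in> cexterior \<epsilon> \<longleftrightarrow> p \<in> cexterior \<epsilon>"
  by (simp_all add: exterior_eq cexterior_def dist_center_yreflect)

lemma dist_centers: "0 < \<epsilon> \<Longrightarrow> dist (center1 \<epsilon>) (center2 \<epsilon>) = 2 + \<epsilon>"
  by (simp add: dist_vec3)

text \<open>The point moves to distance \<open>1 + h\<close> from its own centre; by the triangle
  inequality the other centre, \<open>2 + \<epsilon>\<close> away from the first, stays at distance
  at least \<open>1 + \<epsilon> - h > 1\<close>.\<close>

lemma normal_ray_in_exterior:
  assumes "0 < \<epsilon>" "c \<in> {center1 \<epsilon>, center2 \<epsilon>}" "p \<in> sphere c 1" "0 < h" "h < \<epsilon>"
  shows "p + h *\<^sub>R (p - c) \<in> exterior \<epsilon>"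
proof -
  have n: "norm (p - c) = 1" using assms(3) by (simp add: dist_norm norm_minus_commute)
  have "p + h *\<^sub>R (p - c) - c = (1 + h) *\<^sub>R (p - c)" by (simp add: algebra_simps)
  then have "dist c (p + h *\<^sub>R (p - c)) = 1 + h"
    using n assms(4) by (simp add: dist_norm norm_minus_commute[of c])
  moreover have "1 < dist c' (p + h *\<^sub>R (p - c))" if "dist c' c = 2 + \<epsilon>" for c'
  proof -
    have "dist c' c \<le> dist c' (p + h *\<^sub>R (p - c)) + dist c (p + h *\<^sub>R (p - c))"
      by (rule dist_triangle2)
    then show ?thesis using calculation that assms(5) by simp
  qed
  ultimately show ?thesis
    using assms dist_centers[OF assms(1)] by (auto simp: exterior_eq dist_commute[of "center2 \<epsilon>" "center1 \<epsilon>"])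
qed

lemma cexterior_cases:
  assumes "p \<in> cexterior \<epsilon>"
  obtains "p \<in> exterior \<epsilon>" | c where "c \<in> {center1 \<epsilon>, center2 \<epsilon>}" "p \<in> sphere c 1"
proof -
  have "p \<in> exterior \<epsilon> \<or> dist (center1 \<epsilon>) p = 1 \<or> dist (center2 \<epsilon>) p = 1"
    using assms by (auto simp: cexterior_def exterior_eq)
  then show thesis using that(1) that(2)[of "center1 \<epsilon>"] that(2)[of "center2 \<epsilon>"] by auto
qed

lemma sphere_subset_cexterior:
  assumes "0 < \<epsilon>" "c \<in> {center1 \<epsilon>, center2 \<epsilon>}"
  shows "sphere c 1 \<subseteq> cexterior \<epsilon>"
proof
  fix p assume "p \<in> sphere c 1"
  then have p: "dist c p = 1" by simp
  have "1 \<le> dist c' p" if "dist c' c = 2 + \<epsilon>" for c'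
    using dist_triangle2[of c' c p] assms(1) p that by simp
  moreover have "dist (center2 \<epsilon>) (center1 \<epsilon>) = 2 + \<epsilon>" "dist (center1 \<epsilon>) (center2 \<epsilon>) = 2 + \<epsilon>"
    using dist_centers[OF assms(1)] by (simp_all add: dist_commute)
  ultimately show "p \<in> cexterior \<epsilon>" using p assms(2) by (auto simp: cexterior_def)
qed

text \<open>Boundary points are limits of exterior points along the outward normal, so conditions
  stated on the closure are available on all of \<open>cexterior \<epsilon>\<close>.\<close>

lemma cexterior_subset_closure:
  assumes "0 < \<epsilon>"
  shows "cexterior \<epsilon> \<subseteq> closure (exterior \<epsilon>)"
proof
  fix p assume "p \<in> cexterior \<epsilon>"
  then show "p \<in> closure (exterior \<epsilon>)"
  proof (cases rule: cexterior_cases)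
    case 1
    then show ?thesis using closure_subset by blast
  next
    case (2 c)
    show ?thesis unfolding closure_approachable
    proof (intro allI impI)
      fix e :: real assume "0 < e"
      define h where "h = min e \<epsilon> / 2"
      have h: "0 < h" "h < \<epsilon>" "h < e" using \<open>0 < e\<close> assms by (auto simp: h_def min_def)
      have "norm (p - c) = 1" using 2 by (simp add: dist_norm norm_minus_commute)
      then have "dist (p + h *\<^sub>R (p - c)) p < e" using h by (simp add: dist_norm)
      then show "\<exists>y\<in>exterior \<epsilon>. dist y p < e"
        using normal_ray_in_exterior[OF assms 2 h(1,2)] by blast
    qed
  qed
qed

text \<open>Collects what the comparison uses about \<open>U\<close>. The Neumann condition is a
  one-sided derivative along the outward ray, since the values of \<open>u\<close> inside the balls
  are arbitrary; the decay is weakened to convergence of \<open>U p - p $ 2\<close> to 0.\<close>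

locale odd_solution =
  fixes \<epsilon> :: real and U :: "real^3 \<Rightarrow> real"
  assumes eps_pos: "0 < \<epsilon>"
    and cont: "continuous_on (cexterior \<epsilon>) U"
    and odd: "p $ 2 = 0 \<Longrightarrow> U p = 0"
    and harmonic: "p \<in> exterior \<epsilon> \<Longrightarrow>
      \<exists>d. (\<forall>i. has_pure_second U p (axis i 1) (d i)) \<and> (\<Sum>i\<in>UNIV. d i) = 0"
    and neumann: "c \<in> {center1 \<epsilon>, center2 \<epsilon>} \<Longrightarrow> p \<in> sphere c 1 \<Longrightarrow>
      ((\<lambda>h. U (p + h *\<^sub>R (p - c))) has_real_derivative 0) (at 0 within {0..})"
    and far: "((\<lambda>p. U p - p $ 2) \<longlongrightarrow> 0) at_infinity"

text \<open>Reflection maps each axis direction to itself up to sign, and a second derivative along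
  a line does not see that sign.\<close>

lemma has_pure_second_yreflect:
  assumes "has_pure_second F (yreflect p) (axis i 1) d"
  shows "has_pure_second (\<lambda>p. F (yreflect p)) p (axis i 1) d"
proof -
  have "has_pure_second F (yreflect p) (yreflect (axis i 1)) d"
    using has_pure_second_minus_direction[OF assms] assms unfolding yreflect_axis by (cases "i = 2") simp_all
  then show ?thesis by (simp add: has_pure_second_def yreflect_add_scaleR)
qed

lemma normal_derivative_within:
  assumes "0 < \<epsilon>" "c \<in> {center1 \<epsilon>, center2 \<epsilon>}" "p \<in> sphere c 1"
    and "(u has_derivative (\<lambda>h. g \<bullet> h)) (at p within closure (exterior \<epsilon>))"
  shows "((\<lambda>h. u (p + h *\<^sub>R (p - c))) has_real_derivative g \<bullet> (p - c)) (at 0 within {0..})"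
proof -
  let ?l = "\<lambda>h. p + h *\<^sub>R (p - c)"
  have line: "(?l has_derivative (\<lambda>h. h *\<^sub>R (p - c))) (at 0 within {0..<\<epsilon>})"
    by (auto intro!: derivative_eq_intros)
  have "?l ` {0..<\<epsilon>} \<subseteq> closure (exterior \<epsilon>)"
  proof safe
    fix h assume h: "h \<in> {0..<\<epsilon>}"
    have "p \<in> closure (exterior \<epsilon>)"
      using assms(3) sphere_subset_cexterior[OF assms(1,2)] cexterior_subset_closure[OF assms(1)] by blast
    then show "?l h \<in> closure (exterior \<epsilon>)"
      using normal_ray_in_exterior[OF assms(1-3), of h] h closure_subset[of "exterior \<epsilon>"]
      by (cases "h = 0") auto
  qed
  then have "(u has_derivative (\<lambda>h. g \<bullet> h)) (at (?l 0) within ?l ` {0..<\<epsilon>})"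
    using has_derivative_subset[OF assms(4)] by simp
  from has_derivative_in_compose[OF line this]
  have "((\<lambda>h. u (?l h)) has_real_derivative g \<bullet> (p - c)) (at 0 within {0..<\<epsilon>})"
    by (simp add: has_field_derivative_def mult_commute_abs)
  \<comment> \<open>The ray is known to stay in the closed exterior only for
    \<open>h < \<epsilon>\<close>, but the one-sided derivative depends on small \<open>h\<close>
    alone.\<close>
  moreover have "at 0 within {0..<\<epsilon>} = at 0 within {0..}"
    by (rule at_within_nhd[of _ "{..<\<epsilon>}"]) (use assms(1) in auto)
  ultimately show ?thesis by simp
qed

text \<open>Reflection preserves the norm and flips the sign of \<open>p $ 2\<close>, so the
  expression is half the difference of \<open>u p - p $ 2\<close> and its reflected copy, both of
  which tend to 0.\<close>

lemma odd_part_tendsto: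
  assumes "(\<lambda>p. u p - p $ 2) \<in> O[at_infinity](\<lambda>p :: real^3. 1 / norm p ^ 2)"
  shows "((\<lambda>p. (u p - u (yreflect p)) / 2 - p $ 2) \<longlongrightarrow> 0) at_infinity"
proof -
  have l: "((\<lambda>p :: real^3. 1 / norm p ^ 2) \<longlongrightarrow> 0) at_infinity"
    by (intro tendsto_divide_0[OF tendsto_const] filterlim_at_top_imp_at_infinity
        filterlim_pow_at_top filterlim_norm_at_top) auto
  have r: "filterlim yreflect at_infinity at_infinity"
    using filterlim_norm_at_top by (simp add: filterlim_at_infinity_conv_norm_at_top)
  have a: "((\<lambda>p. u p - p $ 2) \<longlongrightarrow> 0) at_infinity"
  proof -
    obtain k where "\<forall>\<^sub>F p in at_infinity. norm (u p - p $ 2) \<le> k * norm (1 / norm p ^ 2)"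
      using landau_o.bigE[OF assms] by blast
    then show ?thesis
      by (rule Lim_null_comparison) (use tendsto_mult_left[OF tendsto_norm[OF l], of k] in simp)
  qed
  have "((\<lambda>p. u (yreflect p) - yreflect p $ 2) \<longlongrightarrow> 0) at_infinity"
    by (rule filterlim_compose[OF a r])
  from tendsto_divide[OF tendsto_diff[OF a this] tendsto_const[of 2]]
  have "((\<lambda>p. (u p - p $ 2 - (u (yreflect p) - yreflect p $ 2)) / 2) \<longlongrightarrow> 0) at_infinity"
    by simp
  moreover have "(u p - p $ 2 - (u (yreflect p) - yreflect p $ 2)) / 2 = (u p - u (yreflect p)) / 2 - p $ 2" for p
    by (simp add: field_simps)
  ultimately show ?thesis by (simp only:)
qed

text \<open>The Laplace equation and the Neumann condition are linear and invariant under the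
  reflection, which fixes both centres, so the odd part inherits them.\<close>

lemma odd_part_odd_solution:
  assumes "0 < \<epsilon>" "insulated_solution \<epsilon> (\<lambda>p. p $ 2) u"
  shows "odd_solution \<epsilon> (\<lambda>p. (u p - u (yreflect p)) / 2)"
proof
  from assms(2) have h: "harmonic_on (exterior \<epsilon>) u"
    and f: "(\<lambda>p. u p - p $ 2) \<in> O[at_infinity](\<lambda>p. 1 / norm p ^ 2)"
    unfolding insulated_solution_def by auto
  from assms(2) obtain G where G: "\<And>p. p \<in> closure (exterior \<epsilon>) \<Longrightarrow>
      (u has_derivative (\<lambda>h. G p \<bullet> h)) (at p within closure (exterior \<epsilon>))"
    and N: "\<And>c p. c \<in> {center1 \<epsilon>, center2 \<epsilon>} \<Longrightarrow> p \<in> sphere c 1 \<Longrightarrow> G p \<bullet> (p - c) = 0"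
    unfolding insulated_solution_def by blast
  show "0 < \<epsilon>" by fact
  have "continuous_on (closure (exterior \<epsilon>)) u"
    unfolding continuous_on_eq_continuous_within using has_derivative_continuous[OF G] by blast
  then have cu: "continuous_on (cexterior \<epsilon>) u"
    by (rule continuous_on_subset[OF _ cexterior_subset_closure[OF assms(1)]])
  have "continuous_on (cexterior \<epsilon>) (\<lambda>p. u (yreflect p))"
    by (rule continuous_on_compose2[OF cu linear_continuous_on[OF bounded_linear_yreflect]]) auto
  with cu show "continuous_on (cexterior \<epsilon>) (\<lambda>p. (u p - u (yreflect p)) / 2)"
    by (intro continuous_intros) auto
  show "(u p - u (yreflect p)) / 2 = 0" if "p $ 2 = 0" for p
  proof -
    have "yreflect p = p" using that by (simp add: vec_eq_iff forall_3)
    then show ?thesis by simp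
  qed
  show "\<exists>d. (\<forall>i. has_pure_second (\<lambda>p. (u p - u (yreflect p)) / 2) p (axis i 1) (d i)) \<and> (\<Sum>i\<in>UNIV. d i) = 0"
    if p: "p \<in> exterior \<epsilon>" for p
  proof -
    let ?D = "\<lambda>q i. frechet_derivative (grad u) (at q) (axis i 1) \<bullet> axis i 1"
    have C: "C2_on (exterior \<epsilon>) u" and L: "\<And>q. q \<in> exterior \<epsilon> \<Longrightarrow> (\<Sum>i\<in>UNIV. ?D q i) = 0"
      using h by (auto simp: harmonic_on_def laplacian_eq_sum_axis)
    have "has_pure_second (\<lambda>p. (u p - u (yreflect p)) / 2) p (axis i 1) ((?D p i - ?D (yreflect p) i) / 2)" for i
      using p by (intro has_pure_second_divide has_pure_second_diff has_pure_second_yreflect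
          C2_on_has_pure_second[OF C open_exterior]) auto
    moreover have "(\<Sum>i\<in>UNIV. (?D p i - ?D (yreflect p) i) / 2) = 0"
      using L[OF p] L[of "yreflect p"] p unfolding sum_divide_distrib[symmetric] sum_subtractf by simp
    ultimately show ?thesis by (intro exI[of _ "\<lambda>i. (?D p i - ?D (yreflect p) i) / 2"]) auto
  qed
  show "((\<lambda>h. (u (p + h *\<^sub>R (p - c)) - u (yreflect (p + h *\<^sub>R (p - c)))) / 2) has_real_derivative 0) (at 0 within {0..})"
    if c: "c \<in> {center1 \<epsilon>, center2 \<epsilon>}" and p: "p \<in> sphere c 1" for c p
  proof -
    have *: "((\<lambda>h. u (q + h *\<^sub>R (q - c))) has_real_derivative 0) (at 0 within {0..})" if q: "q \<in> sphere c 1" for q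
    proof -
      have "q \<in> closure (exterior \<epsilon>)"
        using q sphere_subset_cexterior[OF assms(1) c] cexterior_subset_closure[OF assms(1)] by blast
      then show ?thesis
        using normal_derivative_within[OF assms(1) c q G] N[OF c q] by simp
    qed
    have cc: "yreflect c = c" using c by auto
    have "yreflect p \<in> sphere c 1" using p dist_yreflect[of c p] by (simp add: cc)
    moreover have "yreflect (p + h *\<^sub>R (p - c)) = yreflect p + h *\<^sub>R (yreflect p - c)" for h
      using yreflect_add_scaleR[of p "-1" c] by (simp add: yreflect_add_scaleR cc)
    ultimately show ?thesis
      using DERIV_cdivide[OF DERIV_diff[OF *[OF p] *[of "yreflect p"]], of 2] by simp
  qed
  show "((\<lambda>p. (u p - u (yreflect p)) / 2 - p $ 2) \<longlongrightarrow> 0) at_infinity"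
    by (rule odd_part_tendsto[OF f])
qed

section \<open>The comparison principle\<close>

definition C2_pos :: "(real \<Rightarrow> real) \<Rightarrow> (real \<Rightarrow> real) \<Rightarrow> (real \<Rightarrow> real) \<Rightarrow> bool" where
  "C2_pos F F' F'' \<longleftrightarrow> (\<forall>s>0. (F has_real_derivative F' s) (at s) \<and> (F' has_real_derivative F'' s) (at s))"

definition radius2 :: "real^3 \<Rightarrow> real" where
  "radius2 p = (p $ 2)\<^sup>2 + (p $ 3)\<^sup>2"

definition barrier :: "(real \<Rightarrow> real) \<Rightarrow> (real \<Rightarrow> real) \<Rightarrow> real^3 \<Rightarrow> real" where
  "barrier F K p = p $ 2 * (F (radius2 p) + (p $ 1)\<^sup>2 * K (radius2 p))"

lemma C2_pos_linear_comb:
  assumes "C2_pos F F' F''" "C2_pos K K' K''"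
  shows "C2_pos (\<lambda>s. F s + a * K s) (\<lambda>s. F' s + a * K' s) (\<lambda>s. F'' s + a * K'' s)"
  using assms unfolding C2_pos_def by (auto intro!: derivative_eq_intros)

lemma has_pure_second_barrier_1:
  "has_pure_second (barrier F K) p (axis 1 1) (p $ 2 * (2 * K (radius2 p)))"
  unfolding has_pure_second_def
proof (intro exI conjI always_eventually allI)
  fix s
  show "((\<lambda>s. barrier F K (p + s *\<^sub>R axis 1 1)) has_real_derivative p $ 2 * (2 * (p $ 1 + s) * K (radius2 p))) (at s)"
    unfolding barrier_def radius2_def by (auto intro!: derivative_eq_intros simp: axis_def)
  show "((\<lambda>s. p $ 2 * (2 * (p $ 1 + s) * K (radius2 p))) has_real_derivative p $ 2 * (2 * K (radius2 p))) (at 0)"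
    by (auto intro!: derivative_eq_intros)
qed

text \<open>With \<open>x\<close> frozen, the barrier along this line is
  \<open>(y + s) * \<Phi> (T s)\<close>, a function of one variable. \<open>T s\<close> is positive
  for \<open>s > - y\<close>, hence near 0, so derivatives on positive arguments, as in
  \<open>C2_pos\<close>, suffice.\<close>

lemma has_pure_second_barrier_2:
  assumes "C2_pos F F' F''" "C2_pos K K' K''" "0 < p $ 2"
  defines "t \<equiv> radius2 p" and "x \<equiv> p $ 1" and "y \<equiv> p $ 2"
  shows "has_pure_second (barrier F K) p (axis 2 1)
    (6 * y * (F' t + x\<^sup>2 * K' t) + 4 * y ^ 3 * (F'' t + x\<^sup>2 * K'' t))"
proof -
  define \<Phi> where "\<Phi> = (\<lambda>s. F s + x\<^sup>2 * K s)"
  define \<Phi>' where "\<Phi>' = (\<lambda>s. F' s + x\<^sup>2 * K' s)"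
  define \<Phi>'' where "\<Phi>'' = (\<lambda>s. F'' s + x\<^sup>2 * K'' s)"
  define T where "T = (\<lambda>s. (y + s)\<^sup>2 + (p $ 3)\<^sup>2)"
  have C: "C2_pos \<Phi> \<Phi>' \<Phi>''" unfolding \<Phi>_def \<Phi>'_def \<Phi>''_def by (rule C2_pos_linear_comb) fact+
  have Tpos: "0 < T s" if "- y < s" for s using that by (simp add: T_def add_pos_nonneg)
  have dT: "(T has_real_derivative 2 * (y + s)) (at s)" for s
    unfolding T_def by (auto intro!: derivative_eq_intros)
  have d\<Phi>: "((\<lambda>s. \<Phi> (T s)) has_real_derivative \<Phi>' (T s) * (2 * (y + s))) (at s)"
    and d\<Phi>': "((\<lambda>s. \<Phi>' (T s)) has_real_derivative \<Phi>'' (T s) * (2 * (y + s))) (at s)" if "- y < s" for s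
    using C Tpos[OF that] unfolding C2_pos_def by (blast intro: DERIV_chain2[OF _ dT])+
  have B: "(\<lambda>s. barrier F K (p + s *\<^sub>R axis 2 1)) = (\<lambda>s. (y + s) * \<Phi> (T s))"
    by (simp add: fun_eq_iff barrier_def radius2_def axis_def \<Phi>_def T_def x_def y_def)
  have t: "t = T 0" by (simp add: t_def T_def radius2_def y_def)
  show ?thesis unfolding has_pure_second_def B
  proof (intro exI conjI)
    have "\<forall>\<^sub>F s in nhds 0. - y < s"
      using assms(3) unfolding y_def by (intro eventually_nhds_in_open[of "{- p $ 2<..}", simplified]) auto
    then show "\<forall>\<^sub>F s in nhds 0. ((\<lambda>s. (y + s) * \<Phi> (T s)) has_real_derivative
        (\<lambda>s. \<Phi> (T s) + 2 * (y + s)\<^sup>2 * \<Phi>' (T s)) s) (at s)"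
    proof eventually_elim
      case (elim s)
      show ?case
        by (rule derivative_eq_intros refl d\<Phi>[OF elim])+ (simp add: algebra_simps power2_eq_square)
    qed
    have y: "- y < 0" using assms(3) by (simp add: y_def)
    show "((\<lambda>s. \<Phi> (T s) + 2 * (y + s)\<^sup>2 * \<Phi>' (T s)) has_real_derivative
        6 * y * (F' t + x\<^sup>2 * K' t) + 4 * y ^ 3 * (F'' t + x\<^sup>2 * K'' t)) (at 0)"
      by (rule derivative_eq_intros refl d\<Phi>[OF y] d\<Phi>'[OF y])+
        (simp add: t \<Phi>'_def \<Phi>''_def algebra_simps power2_eq_square power3_eq_cube)
  qed
qed

lemma has_pure_second_barrier_3:
  assumes "C2_pos F F' F''" "C2_pos K K' K''" "0 < p $ 2"
  defines "t \<equiv> radius2 p" and "x \<equiv> p $ 1" and "y \<equiv> p $ 2" and "z \<equiv> p $ 3"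
  shows "has_pure_second (barrier F K) p (axis 3 1)
    (2 * y * (F' t + x\<^sup>2 * K' t) + 4 * y * z\<^sup>2 * (F'' t + x\<^sup>2 * K'' t))"
proof -
  define \<Phi> where "\<Phi> = (\<lambda>s. F s + x\<^sup>2 * K s)"
  define \<Phi>' where "\<Phi>' = (\<lambda>s. F' s + x\<^sup>2 * K' s)"
  define \<Phi>'' where "\<Phi>'' = (\<lambda>s. F'' s + x\<^sup>2 * K'' s)"
  define T where "T = (\<lambda>s. y\<^sup>2 + (z + s)\<^sup>2)"
  have C: "C2_pos \<Phi> \<Phi>' \<Phi>''" unfolding \<Phi>_def \<Phi>'_def \<Phi>''_def by (rule C2_pos_linear_comb) fact+
  have Tpos: "0 < T s" for s using assms(3) by (simp add: T_def y_def add_pos_nonneg)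
  have dT: "(T has_real_derivative 2 * (z + s)) (at s)" for s
    unfolding T_def by (auto intro!: derivative_eq_intros)
  have d\<Phi>: "((\<lambda>s. \<Phi> (T s)) has_real_derivative \<Phi>' (T s) * (2 * (z + s))) (at s)"
    and d\<Phi>': "((\<lambda>s. \<Phi>' (T s)) has_real_derivative \<Phi>'' (T s) * (2 * (z + s))) (at s)" for s
    using C Tpos unfolding C2_pos_def by (blast intro: DERIV_chain2[OF _ dT])+
  have B: "(\<lambda>s. barrier F K (p + s *\<^sub>R axis 3 1)) = (\<lambda>s. y * \<Phi> (T s))"
    by (simp add: fun_eq_iff barrier_def radius2_def axis_def \<Phi>_def T_def x_def y_def z_def)
  have t: "t = T 0" by (simp add: t_def T_def radius2_def y_def z_def)
  show ?thesis unfolding has_pure_second_def B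
  proof (intro exI conjI always_eventually allI)
    fix s
    show "((\<lambda>s. y * \<Phi> (T s)) has_real_derivative (\<lambda>s. 2 * y * (z + s) * \<Phi>' (T s)) s) (at s)"
      by (rule derivative_eq_intros refl d\<Phi>)+ (simp add: algebra_simps)
    show "((\<lambda>s. 2 * y * (z + s) * \<Phi>' (T s)) has_real_derivative
        2 * y * (F' t + x\<^sup>2 * K' t) + 4 * y * z\<^sup>2 * (F'' t + x\<^sup>2 * K'' t)) (at 0)"
      by (rule derivative_eq_intros refl d\<Phi>')+
        (simp add: t \<Phi>'_def \<Phi>''_def algebra_simps power2_eq_square)
  qed
qed

text \<open>The centre lies on the x-axis, so along the ray y and z scale by \<open>1 + h\<close>:
  \<open>t\<close> becomes \<open>t * (1 + h)^2\<close>, while \<open>x\<close> moves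
  linearly.\<close>

lemma barrier_normal_derivative:
  assumes "C2_pos F F' F''" "C2_pos K K' K''" "0 < p $ 2"
    and "c $ 2 = 0" "c $ 3 = 0"
  defines "t \<equiv> radius2 p" and "x \<equiv> p $ 1"
  shows "((\<lambda>h. barrier F K (p + h *\<^sub>R (p - c))) has_real_derivative
    p $ 2 * (F t + x\<^sup>2 * K t + 2 * t * (F' t + x\<^sup>2 * K' t) + 2 * x * (x - c $ 1) * K t)) (at 0)"
proof -
  define T where "T = (\<lambda>h. t * (1 + h)\<^sup>2)"
  have tpos: "0 < t" using assms(3) by (simp add: t_def radius2_def add_pos_nonneg)
  have T0: "T 0 = t" by (simp add: T_def)
  have dT: "(T has_real_derivative 2 * t) (at 0)"
    unfolding T_def by (auto intro!: derivative_eq_intros)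
  have dF: "((\<lambda>s. F (T s)) has_real_derivative F' t * (2 * t)) (at 0)"
    using assms(1) tpos unfolding C2_pos_def by (intro DERIV_chain2[OF _ dT]) (auto simp: T0)
  have dK: "((\<lambda>s. K (T s)) has_real_derivative K' t * (2 * t)) (at 0)"
    using assms(2) tpos unfolding C2_pos_def by (intro DERIV_chain2[OF _ dT]) (auto simp: T0)
  have "radius2 (p + h *\<^sub>R (p - c)) = T h" for h
    using assms(4,5) by (simp add: radius2_def T_def t_def) (simp add: algebra_simps power2_eq_square)
  then have B: "(\<lambda>h. barrier F K (p + h *\<^sub>R (p - c))) =
      (\<lambda>h. p $ 2 * (1 + h) * (F (T h) + (x + h * (x - c $ 1))\<^sup>2 * K (T h)))"
    using assms(4) by (simp add: fun_eq_iff barrier_def x_def algebra_simps)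
  show ?thesis unfolding B
    by (rule derivative_eq_intros refl dF dK)+ (simp add: T0 algebra_simps power2_eq_square)
qed

lemma right_max_derivative_nonpos:
  assumes "(f has_real_derivative d) (at 0 within {0..})" "0 < r"
    and "\<And>h. 0 < h \<Longrightarrow> h < r \<Longrightarrow> f h \<le> f (0 :: real)"
  shows "d \<le> 0"
proof -
  have "((\<lambda>h. (f h - f 0) / (h - 0)) \<longlongrightarrow> d) (at 0 within {0..})"
    using assms(1) by (simp add: has_field_derivative_iff)
  then have "((\<lambda>h. (f h - f 0) / (h - 0)) \<longlongrightarrow> d) (at_right 0)"
    by (rule tendsto_within_subset) auto
  moreover have "\<forall>\<^sub>F h in at_right 0. (f h - f 0) / (h - 0) \<le> 0"
    unfolding eventually_at_right_field
    using assms(2,3) by (intro exI[of _ r]) (auto simp: divide_le_0_iff)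
  ultimately show ?thesis
    by (intro tendsto_upperbound[of _ d "at_right 0"]) auto
qed

section \<open>The maximum principle and the linear lower bound\<close>

context odd_solution
begin

text \<open>At a local maximum of \<open>barrier F K - U\<close> the Laplacian of the barrier would be
  nonpositive, and so would be its normal derivative if the point is on one of the spheres.\<close>

lemma barrier_no_local_max:
  assumes C: "C2_pos F F' F''" "C2_pos K K' K''"
    and p: "p \<in> cexterior \<epsilon>" "0 < p $ 2" and "0 < r"
    and max: "\<And>q. q \<in> cexterior \<epsilon> \<Longrightarrow> dist q p < r \<Longrightarrow> barrier F K q - U q \<le> barrier F K p - U p"
  defines "t \<equiv> radius2 p" and "x \<equiv> p $ 1"
  assumes subharmonic:
      "p \<in> exterior \<epsilon> \<Longrightarrow> 0 < 2 * K t + 8 * (F' t + x\<^sup>2 * K' t) + 4 * t * (F'' t + x\<^sup>2 * K'' t)"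
    and normal: "\<And>c. c \<in> {center1 \<epsilon>, center2 \<epsilon>} \<Longrightarrow> p \<in> sphere c 1 \<Longrightarrow>
      0 < F t + x\<^sup>2 * K t + 2 * t * (F' t + x\<^sup>2 * K' t) + 2 * x * (x - c $ 1) * K t"
  shows False
  using p(1)
proof (cases rule: cexterior_cases)
  case 1
  from harmonic[OF 1] obtain d where d: "\<And>i. has_pure_second U p (axis i 1) (d i)" "(\<Sum>i\<in>UNIV. d i) = 0"
    by blast
  have ev: "\<forall>\<^sub>F s in nhds 0. barrier F K (p + s *\<^sub>R axis i 1) - U (p + s *\<^sub>R axis i 1) \<le> barrier F K p - U p" for i
  proof -
    have "((\<lambda>s. p + s *\<^sub>R axis i 1) \<longlongrightarrow> p + 0 *\<^sub>R axis i 1) (nhds 0)"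
      by (intro tendsto_intros filterlim_ident)
    moreover have "open (exterior \<epsilon> \<inter> ball p r)" "p \<in> exterior \<epsilon> \<inter> ball p r"
      using open_exterior 1 \<open>0 < r\<close> by auto
    ultimately have "\<forall>\<^sub>F s in nhds 0. p + s *\<^sub>R axis i 1 \<in> exterior \<epsilon> \<inter> ball p r"
      by (auto dest!: topological_tendstoD)
    then show ?thesis
    proof eventually_elim
      case (elim s)
      then show ?case using exterior_subset_cexterior by (intro max) (auto simp: dist_commute)
    qed
  qed
  let ?y = "p $ 2" and ?z = "p $ 3"
  have 1: "?y * (2 * K t) - d 1 \<le> 0"
    using has_pure_second_local_max[OF has_pure_second_diff[OF has_pure_second_barrier_1 d(1)] ev] by (simp add: t_def)
  have 2: "6 * ?y * (F' t + x\<^sup>2 * K' t) + 4 * ?y ^ 3 * (F'' t + x\<^sup>2 * K'' t) - d 2 \<le> 0"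
    using has_pure_second_local_max[OF has_pure_second_diff[OF has_pure_second_barrier_2[OF C p(2)] d(1)] ev]
    by (simp add: t_def x_def)
  have 3: "2 * ?y * (F' t + x\<^sup>2 * K' t) + 4 * ?y * ?z\<^sup>2 * (F'' t + x\<^sup>2 * K'' t) - d 3 \<le> 0"
    using has_pure_second_local_max[OF has_pure_second_diff[OF has_pure_second_barrier_3[OF C p(2)] d(1)] ev]
    by (simp add: t_def x_def)
  have "d 1 + d 2 + d 3 = 0" using d(2) by (simp add: sum_3)
  \<comment> \<open>The sum of the three second derivatives: \<open>6 y + 2 y\<close> gives the
    factor 8, and \<open>4 y^3 + 4 y z^2 = 4 y t\<close>.\<close>
  moreover have "?y * (2 * K t + 8 * (F' t + x\<^sup>2 * K' t) + 4 * t * (F'' t + x\<^sup>2 * K'' t)) =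
      ?y * (2 * K t) + (6 * ?y * (F' t + x\<^sup>2 * K' t) + 4 * ?y ^ 3 * (F'' t + x\<^sup>2 * K'' t))
      + (2 * ?y * (F' t + x\<^sup>2 * K' t) + 4 * ?y * ?z\<^sup>2 * (F'' t + x\<^sup>2 * K'' t))"
  proof -
    have "t = ?y\<^sup>2 + ?z\<^sup>2" by (simp add: t_def radius2_def)
    then have "?y * (2 * a + 8 * b + 4 * t * e) = ?y * (2 * a) + (6 * ?y * b + 4 * ?y ^ 3 * e) + (2 * ?y * b + 4 * ?y * ?z\<^sup>2 * e)"
      for a b e by (simp add: algebra_simps power2_eq_square power3_eq_cube)
    then show ?thesis .
  qed
  ultimately have "?y * (2 * K t + 8 * (F' t + x\<^sup>2 * K' t) + 4 * t * (F'' t + x\<^sup>2 * K'' t)) \<le> 0"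
    using 1 2 3 by linarith
  moreover have "0 < ?y * (2 * K t + 8 * (F' t + x\<^sup>2 * K' t) + 4 * t * (F'' t + x\<^sup>2 * K'' t))"
    by (rule mult_pos_pos[OF p(2) subharmonic]) fact
  ultimately show False by linarith
next
  case (2 c)
  have c: "c $ 2 = 0" "c $ 3 = 0" using 2 by auto
  have n: "norm (p - c) = 1" using 2 by (simp add: dist_norm norm_minus_commute)
  let ?d = "p $ 2 * (F t + x\<^sup>2 * K t + 2 * t * (F' t + x\<^sup>2 * K' t) + 2 * x * (x - c $ 1) * K t)"
  have "((\<lambda>h. barrier F K (p + h *\<^sub>R (p - c))) has_real_derivative ?d) (at 0 within {0..})"
    using barrier_normal_derivative[OF C p(2) c] unfolding t_def x_def by (rule has_field_derivative_at_within)
  from DERIV_diff[OF this neumann[OF 2]]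
  have D: "((\<lambda>h. barrier F K (p + h *\<^sub>R (p - c)) - U (p + h *\<^sub>R (p - c))) has_real_derivative ?d) (at 0 within {0..})"
    by simp
  have "?d \<le> 0"
  proof (rule right_max_derivative_nonpos[OF D, of "min r \<epsilon>"])
    show "0 < min r \<epsilon>" using \<open>0 < r\<close> eps_pos by simp
    fix h assume h: "0 < h" "h < min r \<epsilon>"
    have "p + h *\<^sub>R (p - c) \<in> cexterior \<epsilon>"
      using normal_ray_in_exterior[OF eps_pos 2, of h] h exterior_subset_cexterior by auto
    moreover have "dist (p + h *\<^sub>R (p - c)) p < r" using h n by (simp add: dist_norm)
    ultimately show "barrier F K (p + h *\<^sub>R (p - c)) - U (p + h *\<^sub>R (p - c))
        \<le> barrier F K (p + 0 *\<^sub>R (p - c)) - U (p + 0 *\<^sub>R (p - c))"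
      using max by simp
  qed
  moreover have "0 < ?d" by (rule mult_pos_pos[OF p(2) normal[OF 2]])
  ultimately show False by linarith
qed

text \<open>Since y is only harmonic, it is perturbed to \<open>W = y (1 + \<delta> t)\<close>,
  which satisfies both strict inequalities of \<open>barrier_no_local_max\<close>. A violation at
  \<open>p\<close> gives \<open>W - U\<close> a maximum over \<open>D\<close> of at least
  \<open>\<eta>\<close>; it lies neither on the sphere of radius \<open>R\<close> nor on y = 0, so
  it is a forbidden local maximum.\<close>

lemma ge_linear:
  assumes "p \<in> cexterior \<epsilon>" "0 \<le> p $ 2"
  shows "p $ 2 \<le> U p"
proof (rule ccontr)
  assume "\<not> p $ 2 \<le> U p"
  define \<eta> where "\<eta> = p $ 2 - U p"
  have \<eta>: "0 < \<eta>" using \<open>\<not> p $ 2 \<le> U p\<close> by (simp add: \<eta>_def)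
  have "\<forall>\<^sub>F q in at_infinity. dist (U q - q $ 2) 0 < \<eta> / 2"
    using tendstoD[OF far, of "\<eta> / 2"] \<eta> by simp
  then obtain R0 where R0: "\<And>q. R0 \<le> norm q \<Longrightarrow> \<bar>U q - q $ 2\<bar> < \<eta> / 2"
    unfolding eventually_at_infinity by (auto simp: dist_real_def)
  define R where "R = max (max R0 (norm p)) 1"
  have R: "R0 \<le> R" "norm p \<le> R" "1 \<le> R" by (auto simp: R_def)
  \<comment> \<open>On the sphere of radius \<open>R\<close>, where \<open>y t \<le> R^3\<close>,
    the perturbation is then at most \<open>\<eta> / 4\<close>. Together with
    \<open>\<bar>U - y\<bar> < \<eta> / 2\<close> this keeps \<open>W - U\<close> below
    \<open>\<eta>\<close> there.\<close>
  define \<delta> where "\<delta> = \<eta> / (4 * R ^ 3)"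
  have \<delta>: "0 < \<delta>" "\<delta> * R ^ 3 = \<eta> / 4" using \<eta> R by (auto simp: \<delta>_def)
  define F where "F = (\<lambda>t::real. 1 + \<delta> * t)"
  define W where "W = barrier F (\<lambda>_. 0)"
  have W: "W q = q $ 2 + \<delta> * (q $ 2 * radius2 q)" for q
    by (simp add: W_def barrier_def F_def algebra_simps)
  define D where "D = cexterior \<epsilon> \<inter> cball 0 R \<inter> {q. 0 \<le> q $ 2}"
  have "compact D" unfolding D_def
    by (intro compact_Int_closed closed_Int_compact closed_cexterior compact_cball
        closed_Collect_le continuous_intros)
  moreover have "continuous_on D (\<lambda>q. W q - U q)"
    unfolding W radius2_def
    by (intro continuous_intros continuous_on_subset[OF cont]) (auto simp: D_def)
  moreover have pD: "p \<in> D" using assms R by (simp add: D_def)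
  ultimately obtain q where q: "q \<in> D" and qmax: "\<And>q'. q' \<in> D \<Longrightarrow> W q' - U q' \<le> W q - U q"
    using continuous_attains_sup[of D "\<lambda>q. W q - U q"] by blast
  have "\<eta> \<le> W p - U p" using \<delta> assms by (simp add: W \<eta>_def radius2_def)
  then have \<eta>q: "\<eta> \<le> W q - U q" using qmax[OF pD] by simp
  have nq: "norm q < R"
  proof (rule ccontr)
    assume "\<not> norm q < R"
    then have eq: "norm q = R" using q by (simp add: D_def)
    have "q $ 2 \<le> R" using component_le_norm_cart[of q 2] eq by simp
    moreover have "radius2 q \<le> R\<^sup>2"
    proof -
      have "radius2 q \<le> (norm q)\<^sup>2" by (simp add: radius2_def norm_eq_sqrt_inner inner_vec_def sum_3 power2_eq_square)
      then show ?thesis by (simp add: eq)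
    qed
    moreover have "0 \<le> radius2 q" "0 \<le> q $ 2" using q by (simp_all add: radius2_def D_def)
    ultimately have "q $ 2 * radius2 q \<le> R * R\<^sup>2" by (intro mult_mono) (use R in auto)
    then have "\<delta> * (q $ 2 * radius2 q) \<le> \<delta> * R ^ 3"
      using \<delta> by (intro mult_left_mono) (auto simp: power2_eq_square power3_eq_cube)
    moreover have "\<bar>U q - q $ 2\<bar> < \<eta> / 2" using R0 R eq by simp
    ultimately show False using \<eta>q \<delta> \<eta> by (simp add: W)
  qed
  have yq: "0 < q $ 2"
  proof (rule ccontr)
    assume "\<not> 0 < q $ 2"
    then have "q $ 2 = 0" using q by (simp add: D_def)
    then show False using \<eta>q \<eta> odd[of q] by (simp add: W)
  qed
  have opn: "open (ball 0 R \<inter> {q :: real^3. 0 < q $ 2})"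
    by (intro open_Int open_ball open_Collect_less continuous_intros)
  obtain r where r: "0 < r" "ball q r \<subseteq> ball 0 R \<inter> {q. 0 < q $ 2}"
    using openE[OF opn, of q] nq yq by auto
  have C: "C2_pos F (\<lambda>_. \<delta>) (\<lambda>_. 0)" "C2_pos (\<lambda>_. 0) (\<lambda>_. 0) (\<lambda>_. 0)"
    unfolding C2_pos_def F_def by (auto intro!: derivative_eq_intros)
  show False
  proof (rule barrier_no_local_max[OF C _ yq r(1)])
    show "q \<in> cexterior \<epsilon>" using q by (simp add: D_def)
    show "barrier F (\<lambda>_. 0) q' - U q' \<le> barrier F (\<lambda>_. 0) q - U q" if "q' \<in> cexterior \<epsilon>" "dist q' q < r" for q'
    proof -
      have "q' \<in> ball 0 R \<inter> {q. 0 < q $ 2}" using r(2) that(2) mem_ball[of q' q r] by (auto simp only: dist_commute)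
      then have "q' \<in> D" using that(1) by (auto simp: D_def)
      from qmax[OF this] show ?thesis by (simp add: W_def)
    qed
    have t: "0 \<le> radius2 q" by (simp add: radius2_def)
    then show "0 < F (radius2 q) + (q $ 1)\<^sup>2 * 0 + 2 * radius2 q * (\<delta> + (q $ 1)\<^sup>2 * 0) + 2 * q $ 1 * (q $ 1 - c $ 1) * 0" for c
      using \<delta>(1) by (simp add: F_def add_nonneg_pos)
  qed (use \<delta> in simp)
qed

end

section \<open>The barrier in the neck\<close>

definition \<mu> :: real where "\<mu> = sqrt 2 / 2 - 1"

lemma \<mu>_quadratic: "2 * \<mu>\<^sup>2 + 4 * \<mu> + 1 = 0"
  by (simp add: \<mu>_def power2_eq_square algebra_simps)

text \<open>The lower bound is just what makes \<open>10 * \<mu> + 3\<close> positive in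
  \<open>neck_normal\<close>; both bounds feed \<open>coef_bounds\<close>.\<close>

lemma \<mu>_bounds: "- 3 / 10 < \<mu>" "\<mu> < - 29 / 100"
proof -
  have "1.4 < sqrt 2" by (rule real_less_rsqrt) (simp add: power2_eq_square)
  moreover have "sqrt 2 < 1.42" by (rule real_less_lsqrt) (simp_all add: power2_eq_square)
  ultimately show "- 3 / 10 < \<mu>" "\<mu> < - 29 / 100" by (simp_all add: \<mu>_def)
qed

text \<open>The choice of \<open>A\<close> and \<open>B\<close> cancels the leading part of the Laplacian of the neck barrier.\<close>

definition coefA :: real where "coefA = - 2 * \<mu> * (\<mu> + 1)"

definition coefB :: real where "coefB = 4 * \<mu> * (\<mu> - 1)"

text \<open>The exponent matters here: \<open>coefA\<close> is dictated by the interior equation,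
  and the quadratic for \<open>\<mu>\<close> turns it into the value for which the leading boundary
  term \<open>1 + 2 * \<mu> - coefA\<close> in \<open>neck_normal\<close> vanishes.\<close>

lemma coefA_eq: "coefA = 2 * \<mu> + 1"
  using \<mu>_quadratic by (simp add: coefA_def algebra_simps power2_eq_square)

lemma coefB_eq: "coefB = - 12 * \<mu> - 2"
  using \<mu>_quadratic by (simp add: coefB_def algebra_simps power2_eq_square)

lemma coef_bounds: "0 < coefA" "coefA < 0.42" "0 < coefB" "coefB < 1.6"
  using \<mu>_bounds by (simp_all add: coefA_eq coefB_eq)

text \<open>With \<open>e = \<epsilon> / \<tau>\<close> and \<open>X = x\<^sup>2 / \<tau>\<^sup>2\<close> the middle term is \<open>x\<^sup>2 K' / \<tau>\<^sup>\<mu>\<close> for the coefficient \<open>K\<close> of \<open>x\<^sup>2\<close>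
  in the neck barrier.\<close>

lemma K_slope_bound:
  assumes "0 < \<tau>" "\<tau> \<le> 1/4" "0 < e" "e \<le> 1/2" "0 \<le> X" "X \<le> 1"
  shows "- 4 \<le> X * (coefA * (\<mu> - 1) + coefB * e * (\<mu> - 2) + 20 * \<mu> * \<tau>)"
proof -
  have "coefA * (1 - \<mu>) \<le> 0.42 * 1.3" using coef_bounds \<mu>_bounds by (intro mult_mono) auto
  moreover have "coefB * e * (2 - \<mu>) \<le> 1.6 * (1/2) * 2.3" using coef_bounds \<mu>_bounds assms by (intro mult_mono) auto
  moreover have "(- \<mu>) * \<tau> \<le> 0.3 * (1/4)" using \<mu>_bounds assms by (intro mult_mono) auto
  \<comment> \<open>The three bounds are 0.546, 1.84 and, after the factor 20, 1.5.\<close>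
  ultimately have S: "coefA * (1 - \<mu>) + coefB * e * (2 - \<mu>) + 20 * ((- \<mu>) * \<tau>) \<le> 4" by simp
  have "0 \<le> coefA * (1 - \<mu>)" "0 \<le> coefB * e * (2 - \<mu>)" "0 \<le> (- \<mu>) * \<tau>"
    using coef_bounds \<mu>_bounds assms
    by (auto intro!: mult_nonneg_nonneg mult_nonpos_nonneg)
  then have "X * (coefA * (1 - \<mu>) + coefB * e * (2 - \<mu>) + 20 * ((- \<mu>) * \<tau>)) \<le> 1 * 4"
    using assms S by (intro mult_mono) auto
  then show ?thesis by (simp add: algebra_simps)
qed

text \<open>\<open>P\<close> stands for \<open>\<tau> powr \<mu>\<close>. Once the leading part
  cancels, the constant 20 contributes 40, the first derivatives of the \<open>x^2\<close>
  coefficient cost at most \<open>8 * 4 = 32\<close>, and its second derivatives have a favourable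
  sign.\<close>

lemma neck_subharmonic:
  fixes P \<tau> \<epsilon> x t :: real
  assumes "0 < P" "0 < \<tau>" "\<tau> \<le> 1/4" "0 < \<epsilon>" "t = \<tau> - 2 * \<epsilon>" "0 \<le> t" "x\<^sup>2 \<le> \<tau>\<^sup>2"
  shows "0 < 2 * (P * (coefA / \<tau> + coefB * \<epsilon> / \<tau>^2 + 20))
    + 8 * (P * \<mu> / \<tau> + x\<^sup>2 * (P * (coefA * (\<mu> - 1) / \<tau>^2 + coefB * \<epsilon> * (\<mu> - 2) / \<tau>^3 + 20 * \<mu> / \<tau>)))
    + 4 * t * (P * (\<mu> * (\<mu> - 1)) / \<tau>^2 + x\<^sup>2 * (P * (coefA * (\<mu> - 1) * (\<mu> - 2) / \<tau>^3
        + coefB * \<epsilon> * (\<mu> - 2) * (\<mu> - 3) / \<tau>^4 + 20 * \<mu> * (\<mu> - 1) / \<tau>^2)))"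
    (is "0 < ?L")
proof -
  define e where "e = \<epsilon> / \<tau>"
  define X where "X = x\<^sup>2 / \<tau>\<^sup>2"
  define Q where "Q = coefA * (\<mu> - 1) * (\<mu> - 2) / \<tau>^3
        + coefB * \<epsilon> * (\<mu> - 2) * (\<mu> - 3) / \<tau>^4 + 20 * \<mu> * (\<mu> - 1) / \<tau>^2"
  have e: "\<epsilon> = e * \<tau>" "0 < e" "e \<le> 1/2" using assms by (auto simp: e_def field_simps)
  have X: "x\<^sup>2 = X * \<tau>\<^sup>2" "0 \<le> X" "X \<le> 1" using assms by (auto simp: X_def)
  have Q: "0 \<le> Q"
    unfolding Q_def using coef_bounds \<mu>_bounds assms
    by (intro add_nonneg_nonneg divide_nonneg_nonneg mult_nonneg_nonneg mult_nonpos_nonpos)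
      (auto intro!: mult_nonneg_nonpos mult_nonpos_nonpos mult_nonneg_nonneg)
  have lead: "2 * (coefA / \<tau> + coefB * \<epsilon> / \<tau>^2) + 8 * (\<mu> / \<tau>) + 4 * t * (\<mu> * (\<mu> - 1) / \<tau>^2) = 0"
    using assms(2) unfolding assms(5) coefA_def coefB_def
    by (simp add: field_simps power2_eq_square)
  have loss: "x\<^sup>2 * (coefA * (\<mu> - 1) / \<tau>^2 + coefB * \<epsilon> * (\<mu> - 2) / \<tau>^3 + 20 * \<mu> / \<tau>)
      = X * (coefA * (\<mu> - 1) + coefB * e * (\<mu> - 2) + 20 * \<mu> * \<tau>)" (is "?S = _")
    using assms(2) unfolding X(1) e(1) by (simp add: field_simps power2_eq_square power3_eq_cube)
  have "?L = P * ((2 * (coefA / \<tau> + coefB * \<epsilon> / \<tau>^2) + 8 * (\<mu> / \<tau>) + 4 * t * (\<mu> * (\<mu> - 1) / \<tau>^2))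
      + 40 + 8 * ?S + 4 * t * (x\<^sup>2 * Q))"
    unfolding Q_def by (simp add: algebra_simps)
  also have "\<dots> = P * (40 + 8 * ?S + 4 * t * (x\<^sup>2 * Q))"
    unfolding lead by simp
  also have "\<dots> > 0"
  proof (rule mult_pos_pos[OF assms(1)])
    have "- 4 \<le> ?S" unfolding loss by (rule K_slope_bound) fact+
    moreover have "0 \<le> 4 * t * (x\<^sup>2 * Q)" using Q assms by simp
    ultimately show "0 < 40 + 8 * ?S + 4 * t * (x\<^sup>2 * Q)" by linarith
  qed
  finally show ?thesis .
qed

text \<open>\<open>n\<close> stands for \<open>x - c $ 1\<close>, and \<open>2 * x * n\<close> is
  replaced by its lower bound \<open>- (t + \<epsilon>)\<close>. What does not cancel costs at most
  \<open>20 * P * \<tau>\<close> from the constant in the \<open>x^2\<close> coefficient and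
  \<open>8 * P * \<tau>\<close> from its slope; as \<open>P * \<tau> \<le> 1\<close>, the constant
  30 absorbs both.\<close>

lemma neck_normal:
  fixes P \<tau> \<epsilon> x t n :: real
  assumes "0 < P" "0 < \<tau>" "\<tau> \<le> 1/4" "0 < \<epsilon>" "t = \<tau> - 2 * \<epsilon>" "0 \<le> t" "x\<^sup>2 \<le> \<tau>\<^sup>2"
    and "P * \<tau> \<le> 1" "- (t + \<epsilon>) \<le> 2 * x * n"
  shows "0 < P + 30 + x\<^sup>2 * (P * (coefA / \<tau> + coefB * \<epsilon> / \<tau>^2 + 20))
    + 2 * t * (P * \<mu> / \<tau> + x\<^sup>2 * (P * (coefA * (\<mu> - 1) / \<tau>^2 + coefB * \<epsilon> * (\<mu> - 2) / \<tau>^3 + 20 * \<mu> / \<tau>)))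
    + 2 * x * n * (P * (coefA / \<tau> + coefB * \<epsilon> / \<tau>^2 + 20))"
proof -
  define e where "e = \<epsilon> / \<tau>"
  define X where "X = x\<^sup>2 / \<tau>\<^sup>2"
  define K where "K = P * (coefA / \<tau> + coefB * \<epsilon> / \<tau>^2 + 20)"
  define S where "S = x\<^sup>2 * (coefA * (\<mu> - 1) / \<tau>^2 + coefB * \<epsilon> * (\<mu> - 2) / \<tau>^3 + 20 * \<mu> / \<tau>)"
  have e: "\<epsilon> = e * \<tau>" "0 < e" "e \<le> 1/2" using assms by (auto simp: e_def field_simps)
  have X: "x\<^sup>2 = X * \<tau>\<^sup>2" "0 \<le> X" "X \<le> 1" using assms by (auto simp: X_def)
  have K: "0 < K" unfolding K_def using coef_bounds assms by (intro mult_pos_pos add_pos_pos) auto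
  have "S = X * (coefA * (\<mu> - 1) + coefB * e * (\<mu> - 2) + 20 * \<mu> * \<tau>)"
    using assms(2) unfolding S_def X(1) e(1) by (simp add: field_simps power2_eq_square power3_eq_cube)
  then have S: "- 4 \<le> S" using K_slope_bound[OF assms(2,3) e(2,3) X(2,3)] by simp
  have "- (8 * \<tau>) \<le> 2 * t * S"
  proof -
    have "2 * t * (- 4) \<le> 2 * t * S" using S assms by (intro mult_left_mono) auto
    then show ?thesis using assms by simp
  qed
  then have 1: "P * (- (8 * \<tau>)) \<le> P * (2 * t * S)" using assms by (intro mult_left_mono) auto
  have 2: "- (t + \<epsilon>) * K \<le> 2 * x * n * K" using assms K by (intro mult_right_mono) auto
  \<comment> \<open>Expansion in \<open>e = \<epsilon> / \<tau>\<close>: the order-zero term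
    vanishes by \<open>coefA_eq\<close>, and the terms in \<open>e\<close> and \<open>e^2\<close>
    have nonnegative coefficients.\<close>
  have 3: "P + 2 * t * (P * \<mu> / \<tau>) - (t + \<epsilon>) * K = P * ((10 * \<mu> + 3) * e + coefB * e\<^sup>2 - 20 * \<tau> + 20 * \<epsilon>)"
  proof -
    have "1 + 2 * t * \<mu> / \<tau> = 1 + 2 * \<mu> - 4 * \<mu> * e"
      using assms(2) by (simp add: assms(5) e_def field_simps)
    moreover have "(t + \<epsilon>) * (coefA / \<tau> + coefB * \<epsilon> / \<tau>^2 + 20) = (1 - e) * (coefA + coefB * e) + 20 * \<tau> - 20 * \<epsilon>"
      using assms(2) by (simp add: assms(5) e_def field_simps power2_eq_square)
    moreover have "1 + 2 * \<mu> - 4 * \<mu> * e - (1 - e) * (coefA + coefB * e) = (10 * \<mu> + 3) * e + coefB * e\<^sup>2"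
      unfolding coefA_eq coefB_eq by (simp add: algebra_simps power2_eq_square)
    ultimately have "1 + 2 * t * \<mu> / \<tau> - (t + \<epsilon>) * (coefA / \<tau> + coefB * \<epsilon> / \<tau>^2 + 20)
        = (10 * \<mu> + 3) * e + coefB * e\<^sup>2 - 20 * \<tau> + 20 * \<epsilon>" by linarith
    moreover have "P + 2 * t * (P * \<mu> / \<tau>) - (t + \<epsilon>) * K
        = P * (1 + 2 * t * \<mu> / \<tau> - (t + \<epsilon>) * (coefA / \<tau> + coefB * \<epsilon> / \<tau>^2 + 20))"
      by (simp add: K_def algebra_simps)
    ultimately show ?thesis by simp
  qed
  have "0 \<le> (10 * \<mu> + 3) * e" "0 \<le> coefB * e\<^sup>2" using e coef_bounds \<mu>_bounds by auto
  then have 4: "P * (- (20 * \<tau>)) \<le> P * ((10 * \<mu> + 3) * e + coefB * e\<^sup>2 - 20 * \<tau> + 20 * \<epsilon>)"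
    using assms by (intro mult_left_mono) auto
  have 5: "0 \<le> x\<^sup>2 * K" using K by simp
  have "0 < 30 - 28 * (P * \<tau>)" using assms by simp
  also have "\<dots> = 30 + P * (- (20 * \<tau>)) + P * (- (8 * \<tau>))" by simp
  also have "\<dots> \<le> 30 + (P + 2 * t * (P * \<mu> / \<tau>) - (t + \<epsilon>) * K) + P * (2 * t * S) + x\<^sup>2 * K"
    using 1 3 4 5 by linarith
  also have "\<dots> \<le> P + 30 + x\<^sup>2 * K + 2 * t * (P * \<mu> / \<tau>) + P * (2 * t * S) + 2 * x * n * K"
    using 2 by (simp add: algebra_simps)
  also have "\<dots> = P + 30 + x\<^sup>2 * K + 2 * t * (P * \<mu> / \<tau> + x\<^sup>2 * (P * (coefA * (\<mu> - 1) / \<tau>^2 + coefB * \<epsilon> * (\<mu> - 2) / \<tau>^3 + 20 * \<mu> / \<tau>)))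
    + 2 * x * n * K"
    by (simp add: S_def algebra_simps)
  finally show ?thesis unfolding K_def .
qed

text \<open>Explains the normalisation by 100: at the outer end of the neck
  \<open>P \<le> 8\<close>, and \<open>8 + 30 + 62 = 100\<close>, so the normalised barrier is at
  most y there.\<close>

lemma neck_lateral:
  fixes P \<tau> \<epsilon> x :: real
  assumes "0 < P" "1/8 \<le> \<tau>" "\<tau> \<le> 1/4" "0 < \<epsilon>" "2 * \<epsilon> \<le> \<tau>" "x\<^sup>2 \<le> \<tau>\<^sup>2" "P * \<tau> \<le> 1"
  shows "P + 30 + x\<^sup>2 * (P * (coefA / \<tau> + coefB * \<epsilon> / \<tau>^2 + 20)) \<le> 100"
proof -
  define e where "e = \<epsilon> / \<tau>"
  have e: "\<epsilon> = e * \<tau>" "0 < e" "e \<le> 1/2" using assms by (auto simp: e_def field_simps)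
  have "P * (1/8) \<le> P * \<tau>" using assms by (intro mult_left_mono) auto
  then have P: "P \<le> 8" using assms(7) by linarith
  have "0 \<le> P * (coefA / \<tau> + coefB * \<epsilon> / \<tau>^2 + 20)" using coef_bounds assms by simp
  then have "x\<^sup>2 * (P * (coefA / \<tau> + coefB * \<epsilon> / \<tau>^2 + 20)) \<le> \<tau>\<^sup>2 * (P * (coefA / \<tau> + coefB * \<epsilon> / \<tau>^2 + 20))"
    using assms by (intro mult_right_mono) auto
  also have "\<dots> = (P * \<tau>) * (coefA + coefB * e + 20 * \<tau>)"
    using assms unfolding e(1) by (simp add: field_simps power2_eq_square)
  also have "\<dots> \<le> 1 * (1 + 1.6 * (1/2) + 20 * (1/4))"
    using assms coef_bounds e by (intro mult_mono add_mono) auto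
  finally have "x\<^sup>2 * (P * (coefA / \<tau> + coefB * \<epsilon> / \<tau>^2 + 20)) \<le> 62" by (rule order_trans) simp
  from add_mono[OF add_right_mono[OF P, of 30] this] show ?thesis by simp
qed

section \<open>Geometry of the gap between the balls\<close>

lemma dist_center_sq:
  "(dist (center1 \<epsilon>) p)\<^sup>2 = (1 + \<epsilon> / 2 + p $ 1)\<^sup>2 + radius2 p"
  "(dist (center2 \<epsilon>) p)\<^sup>2 = (1 + \<epsilon> / 2 - p $ 1)\<^sup>2 + radius2 p"
proof -
  have "(- 1 - \<epsilon> / 2 - p $ 1)\<^sup>2 = (1 + \<epsilon> / 2 + p $ 1)\<^sup>2"
    by (simp add: power2_eq_square algebra_simps)
  then show "(dist (center1 \<epsilon>) p)\<^sup>2 = (1 + \<epsilon> / 2 + p $ 1)\<^sup>2 + radius2 p"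
    by (simp add: dist_vec3 radius2_def)
qed (simp add: dist_vec3 radius2_def)

text \<open>For \<open>w = 1 + \<epsilon> / 2 \<plusminus> x\<close>, being outside the ball means
  \<open>w^2 \<ge> 1 - t\<close>, hence \<open>w \<ge> 1 - t\<close> because \<open>1 - t\<close>
  lies in the unit interval.\<close>

lemma neck_width:
  assumes "p \<in> cexterior \<epsilon>" "0 < \<epsilon>" "\<bar>p $ 1\<bar> \<le> 1" "radius2 p \<le> 1"
  shows "\<bar>p $ 1\<bar> \<le> \<epsilon> / 2 + radius2 p"
proof -
  let ?t = "radius2 p"
  have t: "0 \<le> ?t" by (simp add: radius2_def)
  have *: "1 - ?t \<le> w" if "1 \<le> w\<^sup>2 + ?t" "0 \<le> w" for w :: real
  proof (rule power2_le_imp_le)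
    have "(1 - ?t)\<^sup>2 = 1 - ?t - ?t * (1 - ?t)" by (simp add: power2_eq_square algebra_simps)
    moreover have "0 \<le> ?t * (1 - ?t)" using t assms by simp
    ultimately show "(1 - ?t)\<^sup>2 \<le> w\<^sup>2" using that by linarith
  qed fact
  have "1 \<le> (dist (center1 \<epsilon>) p)\<^sup>2" "1 \<le> (dist (center2 \<epsilon>) p)\<^sup>2"
    using assms(1) by (simp_all add: cexterior_def)
  then have "1 - ?t \<le> 1 + \<epsilon> / 2 + p $ 1" "1 - ?t \<le> 1 + \<epsilon> / 2 - p $ 1"
    unfolding dist_center_sq using assms(2,3) by (intro *; linarith)+
  then show ?thesis by linarith
qed

text \<open>With \<open>w\<close> the axial distance from the centre, the right side is
  \<open>2 w^2 - (2 + \<epsilon>) w\<close> for either ball. On the sphere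
  \<open>w^2 = 1 - t\<close>, and \<open>w \<le> 1 - t / 2\<close> gives the bound, up to a
  nonnegative \<open>\<epsilon> t / 2\<close>.\<close>

lemma neck_normal_component:
  assumes "c \<in> {center1 \<epsilon>, center2 \<epsilon>}" "p \<in> sphere c 1" "0 < \<epsilon>" "\<bar>p $ 1\<bar> \<le> 1" "radius2 p \<le> 1"
  shows "- (radius2 p + \<epsilon>) \<le> 2 * p $ 1 * (p $ 1 - c $ 1)"
proof -
  let ?t = "radius2 p"
  have t: "0 \<le> ?t" by (simp add: radius2_def)
  have *: "- (?t + \<epsilon>) \<le> - (2 * (1 + \<epsilon> / 2 - w) * w)" if w: "w\<^sup>2 + ?t = 1" "0 \<le> w" for w :: real
  proof -
    have "w \<le> 1 - ?t / 2"
    proof (rule power2_le_imp_le)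
      have "(1 - ?t / 2)\<^sup>2 = 1 - ?t + (?t / 2)\<^sup>2" by (simp add: power2_eq_square algebra_simps)
      then show "w\<^sup>2 \<le> (1 - ?t / 2)\<^sup>2" using w(1) zero_le_power2[of "?t / 2"] by linarith
    qed (use assms in simp)
    then have "(2 + \<epsilon>) * w \<le> (2 + \<epsilon>) * (1 - ?t / 2)" using assms by (intro mult_left_mono) auto
    moreover have "(2 + \<epsilon>) * (1 - ?t / 2) = 2 + \<epsilon> - ?t - \<epsilon> * ?t / 2" by (simp add: algebra_simps)
    moreover have "0 \<le> \<epsilon> * ?t / 2" using assms t by simp
    moreover have "2 * (1 + \<epsilon> / 2 - w) * w = (2 + \<epsilon>) * w - 2 * w\<^sup>2"
      by (simp add: power2_eq_square algebra_simps)
    ultimately show ?thesis using w(1) by linarith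
  qed
  from assms(1) show ?thesis
  proof
    assume c: "c = center1 \<epsilon>"
    then have "(1 + \<epsilon> / 2 + p $ 1)\<^sup>2 + ?t = 1" using assms(2) dist_center_sq(1)[of \<epsilon> p] by simp
    moreover have "0 \<le> 1 + \<epsilon> / 2 + p $ 1" using assms by linarith
    ultimately have "- (?t + \<epsilon>) \<le> - (2 * (1 + \<epsilon> / 2 - (1 + \<epsilon> / 2 + p $ 1)) * (1 + \<epsilon> / 2 + p $ 1))"
      by (rule *)
    then show ?thesis by (simp add: c algebra_simps)
  next
    assume "c \<in> {center2 \<epsilon>}"
    then have c: "c = center2 \<epsilon>" by simp
    then have "(1 + \<epsilon> / 2 - p $ 1)\<^sup>2 + ?t = 1" using assms(2) dist_center_sq(2)[of \<epsilon> p] by simp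
    moreover have "0 \<le> 1 + \<epsilon> / 2 - p $ 1" using assms by linarith
    ultimately have "- (?t + \<epsilon>) \<le> - (2 * (1 + \<epsilon> / 2 - (1 + \<epsilon> / 2 - p $ 1)) * (1 + \<epsilon> / 2 - p $ 1))"
      by (rule *)
    then show ?thesis by (simp add: c algebra_simps)
  qed
qed

section \<open>The radial profiles of the neck barrier\<close>

definition neckF :: "real \<Rightarrow> real \<Rightarrow> real" where
  "neckF \<epsilon> t = ((t + 2 * \<epsilon>) powr \<mu> + 30) / 100"

definition neckK :: "real \<Rightarrow> real \<Rightarrow> real" where
  "neckK \<epsilon> t = (t + 2 * \<epsilon>) powr \<mu> *
     (coefA / (t + 2 * \<epsilon>) + coefB * \<epsilon> / (t + 2 * \<epsilon>)^2 + 20) / 100"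

definition neckF1 :: "real \<Rightarrow> real \<Rightarrow> real" where
  "neckF1 \<epsilon> t = (t + 2 * \<epsilon>) powr \<mu> * \<mu> / (t + 2 * \<epsilon>) / 100"

definition neckF2 :: "real \<Rightarrow> real \<Rightarrow> real" where
  "neckF2 \<epsilon> t = (t + 2 * \<epsilon>) powr \<mu> * (\<mu> * (\<mu> - 1)) / (t + 2 * \<epsilon>)^2 / 100"

definition neckK1 :: "real \<Rightarrow> real \<Rightarrow> real" where
  "neckK1 \<epsilon> t = (t + 2 * \<epsilon>) powr \<mu> * (coefA * (\<mu> - 1) / (t + 2 * \<epsilon>)^2
     + coefB * \<epsilon> * (\<mu> - 2) / (t + 2 * \<epsilon>)^3 + 20 * \<mu> / (t + 2 * \<epsilon>)) / 100"

definition neckK2 :: "real \<Rightarrow> real \<Rightarrow> real" where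
  "neckK2 \<epsilon> t = (t + 2 * \<epsilon>) powr \<mu> * (coefA * (\<mu> - 1) * (\<mu> - 2) / (t + 2 * \<epsilon>)^3
     + coefB * \<epsilon> * (\<mu> - 2) * (\<mu> - 3) / (t + 2 * \<epsilon>)^4 + 20 * \<mu> * (\<mu> - 1) / (t + 2 * \<epsilon>)^2) / 100"

text \<open>Every summand of the profiles has this form, up to the constants 30 and 100, and
  differentiation keeps it with \<open>n\<close> raised by one. So one rule serves both orders of
  derivative.\<close>

lemma powr_over_power_derivative:
  fixes \<tau>0 :: real
  assumes "0 < t + \<tau>0"
  shows "((\<lambda>t. (t + \<tau>0) powr a * (k / (t + \<tau>0) ^ n)) has_real_derivative
    (t + \<tau>0) powr a * (k * (a - real n) / (t + \<tau>0) ^ Suc n)) (at t)"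
proof -
  have t: "- \<tau>0 < t" using assms by simp
  have eq: "(s + \<tau>0) powr a * (k / (s + \<tau>0) ^ n) = k * (s + \<tau>0) powr (a - real n)" if "s \<in> {- \<tau>0<..}" for s
    using that by (simp add: powr_diff powr_realpow)
  have "((\<lambda>s. k * (s + \<tau>0) powr (a - real n)) has_real_derivative
      k * ((a - real n) * (t + \<tau>0) powr (a - real n - 1))) (at t)"
    using assms by (auto intro!: derivative_eq_intros)
  also have "(t + \<tau>0) powr (a - real n - 1) = (t + \<tau>0) powr (a - real (Suc n))"
    by (simp add: algebra_simps)
  also have "\<dots> = (t + \<tau>0) powr a / (t + \<tau>0) ^ Suc n"
    using assms by (simp only: powr_diff powr_realpow)
  also have "k * ((a - real n) * ((t + \<tau>0) powr a / (t + \<tau>0) ^ Suc n))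
      = (t + \<tau>0) powr a * (k * (a - real n) / (t + \<tau>0) ^ Suc n)" by (simp only: times_divide_eq_right mult_ac)
  finally show ?thesis
    by (rule has_field_derivative_transform_within_open[of _ _ t "{- \<tau>0<..}"])
      (use t in \<open>auto simp only: eq open_greaterThan greaterThan_iff\<close>)
qed

lemma C2_pos_neckF:
  assumes "0 < \<epsilon>"
  shows "C2_pos (neckF \<epsilon>) (neckF1 \<epsilon>) (neckF2 \<epsilon>)"
  unfolding C2_pos_def
proof (intro allI impI conjI)
  fix s :: real assume "0 < s"
  then have s: "0 < s + 2 * \<epsilon>" using assms by simp
  note D = powr_over_power_derivative[OF s, of \<mu>]
  show "(neckF \<epsilon> has_real_derivative neckF1 \<epsilon> s) (at s)"
    unfolding neckF_def neckF1_def
    using DERIV_cdivide[OF DERIV_add[OF D[of 1 0] DERIV_const[of 30]], of 100] by simp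
  show "(neckF1 \<epsilon> has_real_derivative neckF2 \<epsilon> s) (at s)"
    unfolding neckF1_def neckF2_def
    using DERIV_cdivide[OF D[of \<mu> 1], of 100] by (simp add: numeral_eq_Suc)
qed

lemma C2_pos_neckK:
  assumes "0 < \<epsilon>"
  shows "C2_pos (neckK \<epsilon>) (neckK1 \<epsilon>) (neckK2 \<epsilon>)"
  unfolding C2_pos_def
proof (intro allI impI conjI)
  fix s :: real assume "0 < s"
  then have s: "0 < s + 2 * \<epsilon>" using assms by simp
  note D = powr_over_power_derivative[OF s, of \<mu>]
  show "(neckK \<epsilon> has_real_derivative neckK1 \<epsilon> s) (at s)"
    unfolding neckK_def neckK1_def
    using DERIV_cdivide[OF DERIV_add[OF DERIV_add[OF D[of coefA 1] D[of "coefB * \<epsilon>" 2]] D[of 20 0]], of 100]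
    by (simp add: distrib_left numeral_eq_Suc)
  show "(neckK1 \<epsilon> has_real_derivative neckK2 \<epsilon> s) (at s)"
    unfolding neckK1_def neckK2_def
    using DERIV_cdivide[OF DERIV_add[OF DERIV_add[OF D[of "coefA * (\<mu> - 1)" 2]
            D[of "coefB * \<epsilon> * (\<mu> - 2)" 3]] D[of "20 * \<mu>" 1]], of 100]
    by (simp add: distrib_left numeral_eq_Suc)
qed

section \<open>Comparison in the neck\<close>

context odd_solution
begin

text \<open>The condition on \<open>q $ 1\<close> selects the part of the thin cylinder between the
  balls and discards the parts beyond them; for \<open>\<epsilon> < 1/16\<close> equality is never
  attained, by \<open>neck_facts\<close>.\<close>

definition neck :: "(real^3) set" where
  "neck = cexterior \<epsilon> \<inter> {q. 0 \<le> q $ 2} \<inter> {q. radius2 q \<le> 1/8} \<inter> {q. \<bar>q $ 1\<bar> \<le> 1}"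

lemma compact_neck: "compact neck"
proof -
  have "closed neck"
    unfolding neck_def radius2_def
    by (intro closed_Int closed_cexterior closed_Collect_le continuous_intros)
  moreover have "bounded neck"
  proof (rule boundedI)
    fix q assume q: "q \<in> neck"
    have "\<bar>q $ 1\<bar>\<^sup>2 \<le> 1" using q by (intro power_le_one) (auto simp: neck_def)
    then have "(norm q)\<^sup>2 \<le> 2\<^sup>2"
      using q by (simp add: neck_def radius2_def norm_eq_sqrt_inner inner_vec_def sum_3 power2_eq_square)
    then show "norm q \<le> 2" by (rule power2_le_imp_le) simp
  qed
  ultimately show ?thesis by (simp add: compact_eq_bounded_closed)
qed

lemma neck_facts:
  assumes "q \<in> neck" "\<epsilon> < 1/16"
  defines "\<tau> \<equiv> radius2 q + 2 * \<epsilon>"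
  shows "0 < \<tau>" "\<tau> \<le> 1/4" "0 < \<tau> powr \<mu>" "\<tau> powr \<mu> * \<tau> \<le> 1" "(q $ 1)\<^sup>2 \<le> \<tau>\<^sup>2"
    "radius2 q = \<tau> - 2 * \<epsilon>" "0 \<le> radius2 q" "\<bar>q $ 1\<bar> < 1"
proof -
  show t: "0 \<le> radius2 q" by (simp add: radius2_def)
  then show \<tau>: "0 < \<tau>" using eps_pos by (simp add: \<tau>_def)
  show \<tau>4: "\<tau> \<le> 1/4" using assms by (simp add: neck_def)
  show "0 < \<tau> powr \<mu>" using \<tau> by simp
  have "\<tau> powr \<mu> * \<tau> = \<tau> powr (\<mu> + 1)" using \<tau> by (simp add: powr_add)
  also have "\<dots> \<le> 1 powr (\<mu> + 1)" using \<tau> \<tau>4 \<mu>_bounds by (intro powr_mono2) auto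
  finally show "\<tau> powr \<mu> * \<tau> \<le> 1" by simp
  have w: "\<bar>q $ 1\<bar> \<le> \<epsilon> / 2 + radius2 q"
    using assms(1) by (intro neck_width eps_pos) (auto simp: neck_def)
  then have "\<bar>q $ 1\<bar> \<le> \<tau>" unfolding \<tau>_def using eps_pos by linarith
  then show "(q $ 1)\<^sup>2 \<le> \<tau>\<^sup>2" using \<tau> by (simp add: abs_le_square_iff[symmetric])
  show "radius2 q = \<tau> - 2 * \<epsilon>" by (simp add: \<tau>_def)
  show "\<bar>q $ 1\<bar> < 1" using w assms(1,2) by (simp add: neck_def)
qed

text \<open>Where could \<open>W - U\<close> have a positive maximum over the compact neck? On y = 0
  both functions vanish; at \<open>t = 1/8\<close>, \<open>neck_lateral\<close> and
  \<open>ge_linear\<close> give \<open>W \<le> y \<le> U\<close>; \<open>\<bar>x\<bar> = 1\<close>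
  does not occur. Any other point would be a local maximum in the closed exterior, which
  \<open>barrier_no_local_max\<close> excludes.\<close>

lemma ge_neck_barrier:
  assumes "\<epsilon> < 1/16" "p \<in> neck"
  shows "barrier (neckF \<epsilon>) (neckK \<epsilon>) p \<le> U p"
proof (rule ccontr)
  assume neg: "\<not> barrier (neckF \<epsilon>) (neckK \<epsilon>) p \<le> U p"
  define W where "W = barrier (neckF \<epsilon>) (neckK \<epsilon>)"
  have nz: "q \<in> neck \<Longrightarrow> (q $ 2)\<^sup>2 + (q $ 3)\<^sup>2 + 2 * \<epsilon> \<noteq> 0" for q
    using eps_pos by (intro less_imp_neq[THEN not_sym] add_nonneg_pos) auto
  have "continuous_on neck (\<lambda>q. W q - U q)"
    unfolding W_def barrier_def neckF_def neckK_def radius2_def using nz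
    by (intro continuous_intros continuous_on_subset[OF cont]) (auto simp: neck_def)
  then obtain q where q: "q \<in> neck" and qmax: "\<And>q'. q' \<in> neck \<Longrightarrow> W q' - U q' \<le> W q - U q"
    using continuous_attains_sup[OF compact_neck, of "\<lambda>q. W q - U q"] assms(2) by blast
  have pos: "0 < W q - U q" using qmax[OF assms(2)] neg by (simp add: W_def)
  define t where "t = radius2 q"
  define \<tau> where "\<tau> = t + 2 * \<epsilon>"
  define P where "P = \<tau> powr \<mu>"
  define x where "x = q $ 1"
  have f: "0 < \<tau>" "\<tau> \<le> 1/4" "0 < P" "P * \<tau> \<le> 1" "x\<^sup>2 \<le> \<tau>\<^sup>2" "t = \<tau> - 2 * \<epsilon>" "0 \<le> t" "\<bar>x\<bar> < 1"
    using neck_facts[OF q assms(1)] unfolding P_def \<tau>_def t_def x_def by blast+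
  have yq: "0 < q $ 2"
  proof (rule ccontr)
    assume "\<not> 0 < q $ 2"
    then have "q $ 2 = 0" using q by (simp add: neck_def)
    then show False using pos odd[of q] by (simp add: W_def barrier_def)
  qed
  have tq: "t < 1/8"
  proof (rule ccontr)
    assume "\<not> t < 1/8"
    then have t8: "1/8 \<le> \<tau>" using eps_pos by (simp add: \<tau>_def)
    have "P + 30 + x\<^sup>2 * (P * (coefA / \<tau> + coefB * \<epsilon> / \<tau>^2 + 20)) \<le> 100"
      using f t8 eps_pos by (intro neck_lateral) auto
    then have "neckF \<epsilon> t + x\<^sup>2 * neckK \<epsilon> t \<le> 1"
      unfolding neckF_def neckK_def \<tau>_def[symmetric] P_def[symmetric]
      by (simp only: times_divide_eq_right add_divide_distrib[symmetric]) simp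
    then have "W q \<le> q $ 2 * 1"
      unfolding W_def barrier_def using yq by (intro mult_left_mono) (auto simp: t_def x_def)
    moreover have "q $ 2 \<le> U q" using q by (intro ge_linear) (auto simp: neck_def)
    ultimately show False using pos by simp
  qed
  have opn: "open ({q :: real^3. 0 < q $ 2} \<inter> {q. radius2 q < 1/8} \<inter> {q. \<bar>q $ 1\<bar> < 1})"
    unfolding radius2_def by (intro open_Int open_Collect_less continuous_intros)
  obtain r where r: "0 < r" "ball q r \<subseteq> {q. 0 < q $ 2} \<inter> {q. radius2 q < 1/8} \<inter> {q. \<bar>q $ 1\<bar> < 1}"
    using openE[OF opn, of q] yq tq f(8) by (auto simp: t_def x_def)
  show False
  proof (rule barrier_no_local_max[OF C2_pos_neckF[OF eps_pos] C2_pos_neckK[OF eps_pos] _ yq r(1)], goal_cases)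
    case 1
    show ?case using q by (simp add: neck_def)
  next
    case (2 q')
    have "q' \<in> ball q r" using 2(2) by (simp add: dist_commute)
    then have "q' \<in> neck" using 2(1) r(2) by (force simp: neck_def)
    from qmax[OF this] show ?case by (simp add: W_def)
  next
    case 3
    \<comment> \<open>\<open>neck_subharmonic\<close> concerns 100 times the barrier, hence the
      division.\<close>
    have "0 < (2 * (P * (coefA / \<tau> + coefB * \<epsilon> / \<tau>^2 + 20))
    + 8 * (P * \<mu> / \<tau> + x\<^sup>2 * (P * (coefA * (\<mu> - 1) / \<tau>^2 + coefB * \<epsilon> * (\<mu> - 2) / \<tau>^3 + 20 * \<mu> / \<tau>)))
    + 4 * t * (P * (\<mu> * (\<mu> - 1)) / \<tau>^2 + x\<^sup>2 * (P * (coefA * (\<mu> - 1) * (\<mu> - 2) / \<tau>^3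
        + coefB * \<epsilon> * (\<mu> - 2) * (\<mu> - 3) / \<tau>^4 + 20 * \<mu> * (\<mu> - 1) / \<tau>^2)))) / 100"
      by (intro divide_pos_pos neck_subharmonic f eps_pos) simp
    then show ?case
      unfolding neckK_def neckF1_def neckF2_def neckK1_def neckK2_def t_def[symmetric] x_def[symmetric]
        \<tau>_def[symmetric] P_def[symmetric]
      by (simp only: add_divide_distrib distrib_left times_divide_eq_right)
  next
    case (4 c)
    have "- (t + \<epsilon>) \<le> 2 * x * (x - c $ 1)"
      unfolding t_def x_def using 4 q by (intro neck_normal_component eps_pos) (auto simp: neck_def)
    then have "0 < (P + 30 + x\<^sup>2 * (P * (coefA / \<tau> + coefB * \<epsilon> / \<tau>^2 + 20))
    + 2 * t * (P * \<mu> / \<tau> + x\<^sup>2 * (P * (coefA * (\<mu> - 1) / \<tau>^2 + coefB * \<epsilon> * (\<mu> - 2) / \<tau>^3 + 20 * \<mu> / \<tau>)))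
    + 2 * x * (x - c $ 1) * (P * (coefA / \<tau> + coefB * \<epsilon> / \<tau>^2 + 20))) / 100"
      by (intro divide_pos_pos neck_normal f eps_pos) simp_all
    then show ?case
      unfolding neckK_def neckF_def neckF1_def neckK1_def t_def[symmetric] x_def[symmetric]
        \<tau>_def[symmetric] P_def[symmetric]
      by (simp only: add_divide_distrib distrib_left times_divide_eq_right)
  qed
qed

text \<open>Since \<open>h^2 \<le> \<epsilon>\<close>, the shifted variable
  \<open>h^2 + 2 * \<epsilon>\<close> is at most \<open>3 * \<epsilon>\<close>, and
  \<open>\<mu> < 0\<close> reverses the inequality for powers. The remaining barrier terms are
  nonnegative and are dropped.\<close>

lemma axis_lower_bound:
  assumes "\<epsilon> < 1/16" "\<bar>x\<bar> < \<epsilon> / 2" "0 < h" "h \<le> \<epsilon>"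
  shows "h * ((3 * \<epsilon>) powr \<mu> / 100) \<le> U (vector [x, h, 0])"
proof -
  let ?p = "vector [x, h, 0] :: real^3"
  have t: "radius2 ?p = h\<^sup>2" by (simp add: radius2_def)
  have "h * h \<le> \<epsilon> * 1" using assms by (intro mult_mono) auto
  then have h2: "h\<^sup>2 \<le> \<epsilon>" by (simp add: power2_eq_square)
  have "1 \<le> (dist (center1 \<epsilon>) ?p)\<^sup>2" "1 \<le> (dist (center2 \<epsilon>) ?p)\<^sup>2"
    unfolding dist_center_sq t using assms by (auto intro!: add_increasing2[OF zero_le_power2] one_le_power)
  then have "?p \<in> cexterior \<epsilon>"
    using power2_le_imp_le[of 1 "dist (center1 \<epsilon>) ?p"] power2_le_imp_le[of 1 "dist (center2 \<epsilon>) ?p"]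
    by (simp add: cexterior_def)
  then have p: "?p \<in> neck" using assms h2 by (simp add: neck_def t)
  have "(3 * \<epsilon>) powr \<mu> \<le> (h\<^sup>2 + 2 * \<epsilon>) powr \<mu>"
    using h2 eps_pos \<mu>_bounds by (intro powr_mono2') (auto intro: add_nonneg_pos)
  moreover have "0 \<le> x\<^sup>2 * neckK \<epsilon> (h\<^sup>2)"
    using coef_bounds eps_pos by (simp add: neckK_def)
  ultimately have "(3 * \<epsilon>) powr \<mu> / 100 \<le> neckF \<epsilon> (h\<^sup>2) + x\<^sup>2 * neckK \<epsilon> (h\<^sup>2)"
    by (simp add: neckF_def add_divide_distrib)
  then have "h * ((3 * \<epsilon>) powr \<mu> / 100) \<le> barrier (neckF \<epsilon>) (neckK \<epsilon>) ?p"
    unfolding barrier_def t using assms by (auto intro: mult_left_mono)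
  also have "\<dots> \<le> U ?p" by (rule ge_neck_barrier[OF assms(1) p])
  finally show ?thesis .
qed

end

section \<open>From the barrier to the gradient on the axis\<close>

lemma gradient_lower_bound:
  assumes "0 < \<epsilon>" "\<epsilon> < 1/16" "insulated_solution \<epsilon> (\<lambda>p. p $ 2) u" "\<bar>x\<bar> < \<epsilon> / 2"
  shows "(3 * \<epsilon>) powr \<mu> / 100 \<le> norm (grad u (vector [x, 0, 0]))"
proof -
  interpret odd_solution \<epsilon> "\<lambda>p. (u p - u (yreflect p)) / 2"
    by (rule odd_part_odd_solution) fact+
  let ?p = "vector [x, 0, 0] :: real^3" and ?b = "axis 2 1 :: real^3"
  define g where "g = grad u ?p \<bullet> ?b"
  have "1\<^sup>2 < (dist (center1 \<epsilon>) ?p)\<^sup>2" "1\<^sup>2 < (dist (center2 \<epsilon>) ?p)\<^sup>2"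
    unfolding dist_center_sq using assms(4) by (auto simp: radius2_def intro!: one_less_power)
  then have p: "?p \<in> exterior \<epsilon>"
    using power2_less_imp_less[of 1 "dist (center1 \<epsilon>) ?p"] power2_less_imp_less[of 1 "dist (center2 \<epsilon>) ?p"]
    by (simp add: exterior_eq)
  have "C2_on (exterior \<epsilon>) u" using assms(3) by (simp add: insulated_solution_def harmonic_on_def)
  then have "u differentiable (at ?p)" using p by (simp add: C2_on_def)
  then have D: "(u has_derivative frechet_derivative u (at ?p)) (at ?p)"
    by (simp add: frechet_derivative_works)
  have g: "g = frechet_derivative u (at ?p) ?b"
    unfolding g_def grad_def
    by (simp add: inner_sum_left inner_Basis if_distrib cong: if_cong)
  have dir: "((\<lambda>h. u (?p + h *\<^sub>R (s *\<^sub>R ?b))) has_real_derivative s * g) (at 0)" for s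
  proof -
    have "((\<lambda>h. ?p + h *\<^sub>R (s *\<^sub>R ?b)) has_derivative (\<lambda>h. h *\<^sub>R (s *\<^sub>R ?b))) (at 0)"
      by (auto intro!: derivative_eq_intros)
    from has_derivative_compose[OF this, of u "frechet_derivative u (at ?p)"] D
    have "((\<lambda>h. u (?p + h *\<^sub>R (s *\<^sub>R ?b))) has_derivative (\<lambda>h. frechet_derivative u (at ?p) (h *\<^sub>R (s *\<^sub>R ?b)))) (at 0)"
      by simp
    moreover have "frechet_derivative u (at ?p) (h *\<^sub>R (s *\<^sub>R ?b)) = s * g * h" for h
      by (simp only: linear_scale[OF has_derivative_linear[OF D]] g) simp
    ultimately show ?thesis by (simp only: has_field_derivative_def)
  qed
  have plus: "?p + h *\<^sub>R (1 *\<^sub>R ?b) = vector [x, h, 0]"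
    and minus: "?p + h *\<^sub>R ((- 1) *\<^sub>R ?b) = yreflect (vector [x, h, 0])" for h
    by (simp_all add: vec_eq_iff forall_3 axis_def)
  define k where "k = (3 * \<epsilon>) powr \<mu> / 100"
  define f where "f = (\<lambda>h. h * k - (u (vector [x, h, 0]) - u (yreflect (vector [x, h, 0]))) / 2)"
  \<comment> \<open>The direct and the reflected term have slopes \<open>g\<close> and
    \<open>- g\<close>, so the odd part has slope \<open>g\<close>, the y-derivative of
    \<open>u\<close> itself. The bound on \<open>U\<close> makes \<open>f\<close> maximal at 0 from
    the right.\<close>
  have df: "(f has_real_derivative k - g) (at 0 within {0..})"
    unfolding f_def
    by (rule has_field_derivative_at_within)
      (rule derivative_eq_intros refl dir[of 1, unfolded plus] dir[of "- 1", unfolded minus] | simp)+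
  have "k - g \<le> 0"
  proof (rule right_max_derivative_nonpos[OF df assms(1)])
    fix h assume "0 < h" "h < \<epsilon>"
    then show "f h \<le> f 0"
      using axis_lower_bound[OF assms(2,4), of h] odd[of "vector [x, 0, 0]"] by (simp add: f_def k_def)
  qed
  moreover have "g \<le> norm (grad u ?p)"
    using norm_cauchy_schwarz[of "grad u ?p" ?b] by (simp add: g_def)
  ultimately show ?thesis by (simp add: k_def)
qed

theorem theorem2p2:
  shows "\<exists>C>0. \<exists>\<epsilon>0>0. \<forall>\<epsilon>::real. 0 < \<epsilon> \<and> \<epsilon> < \<epsilon>0 \<longrightarrow>
           (\<forall>u. insulated_solution \<epsilon> (\<lambda>p. p $ 2) u \<longrightarrow>
             (\<forall>x::real. \<bar>x\<bar> < \<epsilon> / 2 \<longrightarrow>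
               norm (grad u (vector [x, 0, 0])) \<ge> C * (1 / \<epsilon> powr ((2 - sqrt 2) / 2))))"
proof (intro exI conjI allI impI)
  \<comment> \<open>\<open>C\<close> comes from splitting
    \<open>(3 * \<epsilon>) powr \<mu> / 100\<close>; the threshold 1/16 keeps
    \<open>\<tau> \<le> 1/8 + 2 * \<epsilon>\<close> below 1/4.\<close>
  show "0 < 3 powr \<mu> / 100" "(0::real) < 1/16" by simp_all
  fix \<epsilon> u x
  assume "0 < \<epsilon> \<and> \<epsilon> < 1/16" and u: "insulated_solution \<epsilon> (\<lambda>p. p $ 2) u" and x: "\<bar>x\<bar> < \<epsilon> / 2"
  then have \<epsilon>: "0 < \<epsilon>" "\<epsilon> < 1/16" by auto
  have "1 / \<epsilon> powr ((2 - sqrt 2) / 2) = \<epsilon> powr \<mu>"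
    by (simp add: \<mu>_def powr_minus_divide[symmetric] diff_divide_distrib)
  then show "norm (grad u (vector [x, 0, 0])) \<ge> 3 powr \<mu> / 100 * (1 / \<epsilon> powr ((2 - sqrt 2) / 2))"
    using gradient_lower_bound[OF \<epsilon> u x] \<epsilon> by (simp add: powr_mult)
qed

end
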